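(* Let $n\geq 5$ and $k\geq 0$ be integers, let $c\in\mathbb{C}$, and let $w,p_{1},p_{2},\alpha_{1},\alpha_{2}$ be non-zero complex constants with $\alpha_{1}\neq\alpha_{2}$. Suppose that $f$ is a transcendental entire function of finite order which is a solution of the differential-difference equation $$f^{n}(z)+wf^{n-1}(z)f'(z)+f^{(k)}(z+c)=p_{1}e^{\alpha_{1}z}+p_{2}e^{\alpha_{2}z}.$$ Then $f$ must be of the form $f(z)=Ce^{az}$, where $a$ and $C$ are non-zero constants such that, for some $i,j\in\{1,2\}$ with $i\neq j$, one has $a=\alpha_{i}$, $na=\alpha_{j}$ and $C=(1+aw)^{-1/n}p_{j}^{1/n}$ (for some choice of the $n$-th roots).
   Context: The order of growth of a meromorphic function $f$ is $\rho(f)=\limsup_{r\to\infty}\frac{\log^{+}T(r,f)}{\log r}$, where $T(r,f)$ is the Nevanlinna characteristic function; finite order means $\rho(f)<\infty$. Here $f^{n}$ denotes the $n$-th power of $f$, and $f^{(k)}$ denotes the $k$-th derivative ($f^{(0)}=f$). *)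

theory Defs
  imports "HOL-Complex_Analysis.Complex_Analysis"
begin

(* Equals max 0 (ln x) for x > 0, and is 0 for x <= 0. *)
definition log_plus :: "real \<Rightarrow> real" where
  "log_plus x = ln (max 1 x)"

definition proximity_fun :: "(complex \<Rightarrow> complex) \<Rightarrow> real \<Rightarrow> real" where
  "proximity_fun f r =
     1 / (2 * pi) * integral {0..2 * pi} (\<lambda>\<theta>. log_plus (norm (f (of_real r * cis \<theta>))))"

(* Poles are counted with multiplicity: a pole of order m has zorder f z = - m. *)
definition pole_count :: "(complex \<Rightarrow> complex) \<Rightarrow> real \<Rightarrow> nat" where
  "pole_count f r = (\<Sum>z | norm z \<le> r \<and> is_pole f z. nat (- zorder f z))"

definition pole_counting_fun :: "(complex \<Rightarrow> complex) \<Rightarrow> real \<Rightarrow> real" where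
  "pole_counting_fun f r =
     integral {0..r} (\<lambda>t. (real (pole_count f t) - real (pole_count f 0)) / t)
     + real (pole_count f 0) * ln r"

(* This and the order of growth below are meaningful for f meromorphic in the whole plane. *)
definition nevanlinna_char :: "(complex \<Rightarrow> complex) \<Rightarrow> real \<Rightarrow> real" where
  "nevanlinna_char f r = proximity_fun f r + pole_counting_fun f r"

definition growth_order :: "(complex \<Rightarrow> complex) \<Rightarrow> ereal" where
  "growth_order f = Limsup at_top (\<lambda>r. ereal (log_plus (nevanlinna_char f r) / ln r))"

definition finite_order :: "(complex \<Rightarrow> complex) \<Rightarrow> bool" where
  "finite_order f \<longleftrightarrow> growth_order f < \<infinity>"

definition transcendental_entire :: "(complex \<Rightarrow> complex) \<Rightarrow> bool" where
  "transcendental_entire f \<longleftrightarrow> f holomorphic_on UNIV \<and> \<not> (\<exists>q. \<forall>z. f z = poly q z)"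

end

theory Submission
  imports Defs "HOL-Real_Asymp.Real_Asymp" "HOL-Computational_Algebra.Fundamental_Theorem_Algebra"
begin

text \<open>
Write \<open>P\<close> for the right-hand side and \<open>L(z) = f\<^sup>(\<^sup>k\<^sup>)(z + c)\<close>, so that the equation reads
\<open>f\<^bsup>n-1\<^esup> (f + w f') = P - L\<close>. The operator \<open>D = (d/dz - \<alpha>\<^sub>1)(d/dz - \<alpha>\<^sub>2)\<close> kills \<open>P\<close>, and applied to
the left-hand side it produces \<open>f\<^bsup>n-3\<^esup> \<psi>\<close> with \<open>\<psi>\<close> a homogeneous cubic polynomial in \<open>f\<close> and its
derivatives. Hence \<open>f\<^bsup>n-3\<^esup> \<psi> = - D L\<close>, where the right-hand side is only linear in \<open>f\<close>. As in Clunie's lemma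
this forces \<open>\<psi> = 0\<close>. What is needed is a supply of circles \<open>|z - z\<^sub>0| = r\<close>, at least one in every range
\<open>[R, 2R]\<close>, on which all the quotients \<open>f\<^sup>(\<^sup>j\<^sup>)(z)/f(z)\<close> and \<open>f\<^sup>(\<^sup>j\<^sup>)(z + c)/f(z)\<close> are at most a power of \<open>r\<close>.
On such a circle both \<open>\<psi>\<close> and \<open>f \<psi>\<close> are at most a power of \<open>r\<close>: use \<open>|\<psi>| \<le> r\<^sup>N |f|\<^sup>3\<close> where \<open>|f| \<le> 1\<close>,
and \<open>|f|\<^bsup>n-3\<^esup> |\<psi>| \<le> r\<^sup>N |f|\<close> where \<open>|f| > 1\<close>; the second step uses \<open>n - 3 \<ge> 2\<close>. So \<open>\<psi>\<close> is a polynomial,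
and if it were not zero then \<open>f\<close> would be one too (\<open>clunie_vanishing\<close>).

The good circles (\<open>good_circles\<close>) exist because \<open>f\<close> has exponential type. Then \<open>f\<close> has \<open>O(R)\<close> zeros in
a disc of radius \<open>4R\<close>, and after division by the corresponding polynomial a zero-free function remains whose
logarithm varies by \<open>O(1)\<close> over bounded distances, by Harnack's inequality. Averaging over the radius finds an
\<open>r\<close> for which the sum of \<open>1/|r - |a||\<close> over these zeros \<open>a\<close> is \<open>O(log R)\<close>, and so the polynomial
factor changes by at most a power of \<open>R\<close> when \<open>z\<close> is moved a bounded distance away from the circle. Cauchy's
inequality turns this statement about values of \<open>f\<close> into one about derivatives.

That \<open>f\<close> has exponential type comes from the equation itself. It says that
\<open>(f\<^sup>n e\<^bsup>nz/w\<^esup>)' = (n/w) e\<^bsup>nz/w\<^esup> (P - L)\<close>, so that \<open>\<phi> = log\<^sup>+ |f|\<close> satisfies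
\<open>n \<phi>(z) \<le> A|z| + B + max \<phi>(u)\<close>, the maximum being over \<open>|u| \<le> |z| + |c| + 1\<close>. Iterating \<open>m\<close> times divides
the contribution of the unknown term by \<open>n\<^sup>m\<close>, while an a priori bound from the finite order of \<open>f\<close> grows only
like a power of \<open>m\<close> (\<open>equation_exponential_type\<close>). The a priori bound is the classical comparison of the
maximum modulus with the proximity function (\<open>norm_le_exp_proximity\<close>).

Once \<open>\<psi> = 0\<close> we have \<open>D L = 0\<close>, hence \<open>f = A\<^sub>1 e\<^bsup>\<alpha>\<^sub>1z\<^esup> + A\<^sub>2 e\<^bsup>\<alpha>\<^sub>2z\<^esup> + q\<close> with a polynomial \<open>q\<close>. Comparing the
growth of both sides of the equation along suitable rays shows that exactly one of \<open>A\<^sub>1\<close>, \<open>A\<^sub>2\<close> is non-zero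
and that \<open>q = 0\<close>.
\<close>

section \<open>Poisson formula and Harnack inequality for zero-free functions\<close>

lemma max_modulus_cball:
  fixes f :: "complex \<Rightarrow> complex"
  assumes "f holomorphic_on UNIV" and "\<And>z. norm z = R \<Longrightarrow> norm (f z) \<le> B"
    and "norm z \<le> R"
  shows "norm (f z) \<le> B"
proof (cases "R > 0")
  case True
  show ?thesis
  proof (rule maximum_modulus_frontier[of f "cball 0 R"])
    show "f holomorphic_on interior (cball 0 R)" "continuous_on (closure (cball 0 R)) f"
      using assms(1) holomorphic_on_imp_continuous_on holomorphic_on_subset
      by (blast, metis subset_UNIV holomorphic_on_imp_continuous_on holomorphic_on_subset)
  qed (use assms in auto)
next
  case False
  then have "norm z = R" using assms(3) norm_ge_zero[of z] by linarith
  then show ?thesis using assms(2) by blast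
qed

text \<open>A zero-free function has a logarithm on a disc slightly larger than the given one, because the
zero set keeps a positive distance from the compact disc; this gives continuity up to the boundary.\<close>

lemma holomorphic_log_on_cball:
  fixes h :: "complex \<Rightarrow> complex"
  assumes h: "h holomorphic_on UNIV" and nz: "\<And>z. norm z \<le> R \<Longrightarrow> h z \<noteq> 0" and R: "R > 0"
  obtains l where "l holomorphic_on ball 0 R" "continuous_on (cball 0 R) l"
    "\<And>z. norm z \<le> R \<Longrightarrow> h z = exp (l z)"
proof -
  have "open (- (h -` {0}))"
    using h by (intro open_Compl closed_vimage) (auto simp: holomorphic_on_imp_continuous_on)
  moreover have "cball 0 R \<subseteq> - (h -` {0})" using nz by auto
  ultimately obtain e where e: "e > 0" "(\<Union>x\<in>cball 0 R. ball x e) \<subseteq> - (h -` {0})"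
    using compact_subset_open_imp_ball_epsilon_subset[of "cball 0 R"] by (metis compact_cball)
  have nz': "h z \<noteq> 0" if "z \<in> ball 0 (R + e)" for z
  proof (cases "norm z \<le> R")
    case False
    then have z: "norm z > R" by simp
    \<comment> \<open>the point of the closed disc nearest to \<open>z\<close>\<close>
    define x where "x = of_real (R / norm z) * z"
    have "z \<noteq> 0" using z R by auto
    then have nx: "norm x = R" using R by (simp add: x_def norm_mult norm_divide)
    have "z - x = of_real (1 - R / norm z) * z" by (simp add: x_def algebra_simps)
    then have "norm (z - x) = \<bar>1 - R / norm z\<bar> * norm z" by (simp only: norm_mult norm_of_real)
    moreover have "R / norm z \<le> 1" using z R \<open>z \<noteq> 0\<close> by (simp add: divide_le_eq)
    ultimately have "dist x z = (1 - R / norm z) * norm z"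
      by (simp add: dist_norm norm_minus_commute)
    moreover have "(1 - R / norm z) * norm z = norm z - R" using \<open>z \<noteq> 0\<close> by (simp add: field_simps)
    ultimately have "dist x z < e" using that by simp
    then show ?thesis using e(2) nx by fastforce
  qed (use nz in auto)
  obtain l where l: "l holomorphic_on ball 0 (R + e)" "\<And>z. z \<in> ball 0 (R+e) \<Longrightarrow> exp (l z) = h z"
    using holomorphic_logarithm_exists[of "ball 0 (R+e)" h 0] nz' R e(1)
      holomorphic_on_subset[OF h] by (auto simp del: mem_ball)
  show ?thesis
  proof (rule that)
    show "l holomorphic_on ball 0 R" using l(1) e(1) by (auto elim!: holomorphic_on_subset)
    show "continuous_on (cball 0 R) l" 
      using holomorphic_on_imp_continuous_on[OF l(1)] e(1) by (auto elim!: continuous_on_subset)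
    show "h z = exp (l z)" if "norm z \<le> R" for z using l(2)[of z] that e(1) by auto
  qed
qed

text \<open>On the circle \<open>R\<^sup>2 = \<zeta> cnj \<zeta>\<close>, which turns the first expression, the kernel that Cauchy's formula delivers,
into the Poisson kernel \<open>(R\<^sup>2 - |z|\<^sup>2)/|\<zeta> - z|\<^sup>2\<close>. The form \<open>Re ((\<zeta> + z)/(\<zeta> - z))\<close> makes differences in \<open>z\<close> easy to
estimate.\<close>

lemma herglotz_kernel:
  fixes \<zeta> z :: complex
  assumes "norm \<zeta> = R" "norm z < R"
  shows "\<zeta> * (of_real R^2 - z * cnj z) / ((\<zeta> - z) * (of_real R^2 - cnj z * \<zeta>))
       = of_real (Re ((\<zeta> + z) / (\<zeta> - z)))"
    and "Re ((\<zeta> + z) / (\<zeta> - z)) \<ge> 0"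
    and "Re ((\<zeta> + z) / (\<zeta> - z)) \<le> (R + norm z) / (R - norm z)"
proof -
  have ne: "\<zeta> \<noteq> z" using assms by auto
  have z0: "\<zeta> \<noteq> 0" using assms norm_ge_zero[of z] by auto
  have R2: "of_real R^2 = \<zeta> * cnj \<zeta>" using assms complex_norm_square[of \<zeta>] by (simp add: power2_eq_square)
  have cne: "cnj \<zeta> - cnj z \<noteq> 0" using ne by (metis complex_cnj_cancel_iff eq_iff_diff_eq_0)
  have "complex_of_real (Re ((\<zeta> + z) / (\<zeta> - z))) = ((\<zeta> + z) / (\<zeta> - z) + cnj ((\<zeta> + z) / (\<zeta> - z))) / 2"
    by (subst complex_add_cnj) simp
  also have "(\<zeta> + z) / (\<zeta> - z) + cnj ((\<zeta> + z) / (\<zeta> - z))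
      = 2 * (\<zeta> * cnj \<zeta> - z * cnj z) / ((\<zeta> - z) * (cnj \<zeta> - cnj z))"
    using ne cne by (simp add: add_frac_eq) (simp add: algebra_simps)
  also have "\<dots> / 2 = (\<zeta> * cnj \<zeta> - z * cnj z) / ((\<zeta> - z) * (cnj \<zeta> - cnj z))"
    by (metis (no_types, lifting) nonzero_mult_div_cancel_left times_divide_eq_right zero_neq_numeral)
  finally have re_eq: "complex_of_real (Re ((\<zeta> + z) / (\<zeta> - z))) = (\<zeta> * cnj \<zeta> - z * cnj z) / ((\<zeta> - z) * (cnj \<zeta> - cnj z))" .
  also have "\<dots> = \<zeta> * (of_real R^2 - z * cnj z) / ((\<zeta> - z) * (of_real R^2 - cnj z * \<zeta>))"
    unfolding R2 using z0 ne cne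
    by (simp add: frac_eq_eq) (auto simp: algebra_simps)
  finally show "\<zeta> * (of_real R^2 - z * cnj z) / ((\<zeta> - z) * (of_real R^2 - cnj z * \<zeta>))
       = of_real (Re ((\<zeta> + z) / (\<zeta> - z)))" ..
  have "(\<zeta> - z) * (cnj \<zeta> - cnj z) = of_real ((norm (\<zeta> - z))^2)"
    by (simp only: complex_norm_square complex_cnj_diff)
  moreover have "\<zeta> * cnj \<zeta> - z * cnj z = of_real (R^2 - (norm z)^2)"
    using assms(1) unfolding of_real_diff complex_norm_square[symmetric] of_real_power by simp
  ultimately have "complex_of_real (Re ((\<zeta> + z) / (\<zeta> - z))) = of_real ((R^2 - (norm z)^2) / (norm (\<zeta> - z))^2)"
    using re_eq by simp
  then have "Re ((\<zeta> + z) / (\<zeta> - z)) = (R^2 - (norm z)^2) / (norm (\<zeta> - z))^2"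
    using of_real_eq_iff by blast
  moreover have "R^2 \<ge> (norm z)^2" using assms by (intro power_mono) auto
  ultimately show "Re ((\<zeta> + z) / (\<zeta> - z)) \<ge> 0" by simp
  have "norm (\<zeta> + z) \<le> R + norm z" "R - norm z \<le> norm (\<zeta> - z)"
    using assms norm_triangle_ineq[of \<zeta> z] norm_triangle_ineq2[of \<zeta> z] by auto
  then have "norm ((\<zeta> + z) / (\<zeta> - z)) \<le> (R + norm z) / (R - norm z)"
    using assms norm_ge_zero[of z] unfolding norm_divide
    by (intro frac_le) auto
  then show "Re ((\<zeta> + z) / (\<zeta> - z)) \<le> (R + norm z) / (R - norm z)"
    using complex_Re_le_cmod order_trans by blast
qed

text \<open>If \<open>l\<close> is a logarithm of \<open>h\<close>, Cauchy's formula is applied at \<open>z\<close> not to \<open>l\<close> but to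
\<open>l(u) (R\<^sup>2 - |z|\<^sup>2)/(R\<^sup>2 - cnj z u)\<close>. This function has the same value at \<open>z\<close> and the resulting kernel is real, so
that taking real parts is harmless.\<close>

lemma poisson_formula_ln_norm:
  fixes h :: "complex \<Rightarrow> complex"
  assumes h: "h holomorphic_on UNIV" and nz: "\<And>z. norm z \<le> R \<Longrightarrow> h z \<noteq> 0" and z: "norm z < R"
  shows "((\<lambda>t. ln (norm (h (of_real R * cis t))) * Re ((of_real R * cis t + z) / (of_real R * cis t - z)))
          has_integral 2 * pi * ln (norm (h z))) {0..2*pi}"
proof -
  have R: "R > 0" using z norm_ge_zero[of z] by linarith
  obtain l where l: "l holomorphic_on ball 0 R" "continuous_on (cball 0 R) l"
    "\<And>z. norm z \<le> R \<Longrightarrow> h z = exp (l z)" using holomorphic_log_on_cball[OF h nz R] by blast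
  have Re_l: "Re (l u) = ln (norm (h u))" if "norm u \<le> R" for u
    using l(3)[OF that] by simp
  have den: "of_real R^2 - cnj z * u \<noteq> 0" if "norm u \<le> R" for u
  proof
    assume "of_real R^2 - cnj z * u = 0"
    then have "cnj z * u = of_real (R^2)" by simp
    then have "norm (cnj z * u) = R^2" by (metis abs_of_nonneg norm_of_real zero_le_power2)
    moreover have "norm (cnj z * u) \<le> norm z * R" using that by (simp add: norm_mult mult_left_mono)
    moreover have "norm z * R < R^2" using z R by (simp add: power2_eq_square)
    ultimately show False by linarith
  qed
  define F where "F u = l u * (of_real R^2 - z * cnj z) / (of_real R^2 - cnj z * u)" for u
  have Fz: "F z = l z" using den[of z] z by (simp add: F_def mult.commute)
  have "((\<lambda>u. F u / (u - z)) has_contour_integral (2 * of_real pi * \<i> * F z)) (circlepath 0 R)"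
  proof (rule Cauchy_integral_circlepath)
    show "continuous_on (cball 0 R) F" unfolding F_def
      by (intro continuous_intros l(2)) (use den in auto)
    show "F holomorphic_on ball 0 R" unfolding F_def
      by (intro holomorphic_intros l(1)) (use den in auto)
  qed (use z in auto)
  then have "((\<lambda>t. F (0 + of_real R * cis t) / (0 + of_real R * cis t - z) * of_real R * \<i> * cis t)
     has_integral (2 * of_real pi * \<i> * l z)) {0..2*pi}"
    unfolding circlepath_def Fz by (subst (asm) has_contour_integral_part_circlepath_iff) auto
  then have "((\<lambda>t. F (of_real R * cis t) / (of_real R * cis t - z) * of_real R * \<i> * cis t * (-\<i>))
     has_integral (2 * of_real pi * \<i> * l z * (-\<i>))) {0..2*pi}"
    by (intro has_integral_mult_left) simp
  then have "((\<lambda>t. Re (F (of_real R * cis t) / (of_real R * cis t - z) * of_real R * \<i> * cis t * (-\<i>)))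
     has_integral Re (2 * of_real pi * \<i> * l z * (-\<i>))) {0..2*pi}"
    by (rule has_integral_linear[OF _ bounded_linear_Re, unfolded o_def])
  moreover have "Re (2 * of_real pi * \<i> * l z * (-\<i>)) = 2 * pi * ln (norm (h z))"
    using Re_l[of z] z by simp
  moreover have "Re (F (of_real R * cis t) / (of_real R * cis t - z) * of_real R * \<i> * cis t * (-\<i>))
     = ln (norm (h (of_real R * cis t))) * Re ((of_real R * cis t + z) / (of_real R * cis t - z))" for t
  proof -
    define \<zeta> where "\<zeta> = of_real R * cis t"
    have n: "norm \<zeta> = R" using R by (simp add: \<zeta>_def norm_mult)
    have "F \<zeta> / (\<zeta> - z) * of_real R * \<i> * cis t * (-\<i>) = F \<zeta> / (\<zeta> - z) * \<zeta> * (\<i> * (-\<i>))"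
      unfolding \<zeta>_def by (simp only: mult_ac)
    also have "\<dots> = l \<zeta> * (\<zeta> * (of_real R^2 - z * cnj z) / ((\<zeta> - z) * (of_real R^2 - cnj z * \<zeta>)))"
      by (simp add: F_def mult_ac)
    also have "\<dots> = l \<zeta> * of_real (Re ((\<zeta> + z) / (\<zeta> - z)))"
      using herglotz_kernel(1)[OF n z] by simp
    finally show ?thesis using Re_l[of \<zeta>] n unfolding \<zeta>_def[symmetric] by simp
  qed
  ultimately show ?thesis by simp
qed

text \<open>The Poisson kernel is at most \<open>(R + |z|)/(R - |z|)\<close>, and \<open>ln\<close> is at most \<open>log\<^sup>+\<close>.\<close>

lemma ln_norm_le_proximity:
  fixes h :: "complex \<Rightarrow> complex"
  assumes h: "h holomorphic_on UNIV" and nz: "\<And>z. norm z \<le> R \<Longrightarrow> h z \<noteq> 0" and z: "norm z < R"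
  shows "ln (norm (h z)) \<le> (R + norm z) / (R - norm z) * proximity_fun h R"
proof -
  have R: "R > 0" using z norm_ge_zero[of z] by linarith
  let ?c = "(R + norm z) / (R - norm z)"
  have c: "continuous_on {0..2*pi} (\<lambda>t. log_plus (norm (h (of_real R * cis t))))"
    unfolding log_plus_def
    by (intro continuous_intros continuous_on_compose2[OF holomorphic_on_imp_continuous_on[OF h]]) auto
  have int: "((\<lambda>t. log_plus (norm (h (of_real R * cis t))) * ?c) has_integral
        integral {0..2*pi} (\<lambda>t. log_plus (norm (h (of_real R * cis t)))) * ?c) {0..2*pi}"
    by (intro has_integral_mult_left integrable_integral integrable_continuous_real c)
  have "2 * pi * ln (norm (h z)) \<le> integral {0..2*pi} (\<lambda>t. log_plus (norm (h (of_real R * cis t)))) * ?c"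
  proof (rule has_integral_le[OF poisson_formula_ln_norm[OF h nz z] int])
    fix t :: real
    define \<zeta> where "\<zeta> = of_real R * cis t"
    have n: "norm \<zeta> = R" using R by (simp add: \<zeta>_def norm_mult)
    have "ln (norm (h \<zeta>)) \<le> log_plus (norm (h \<zeta>))" "0 \<le> log_plus (norm (h \<zeta>))"
      using nz[of \<zeta>] n by (auto simp: log_plus_def)
    then have "ln (norm (h \<zeta>)) * Re ((\<zeta> + z) / (\<zeta> - z)) \<le> log_plus (norm (h \<zeta>)) * ?c"
      using herglotz_kernel(2,3)[OF n z] by (meson mult_left_mono mult_right_mono order_trans)
    then show "ln (norm (h (of_real R * cis t))) * Re ((of_real R * cis t + z) / (of_real R * cis t - z))
        \<le> log_plus (norm (h (of_real R * cis t))) * ?c" by (simp add: \<zeta>_def)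
  qed auto
  then have "ln (norm (h z)) \<le> integral {0..2*pi} (\<lambda>t. log_plus (norm (h (of_real R * cis t)))) * ?c / (2 * pi)"
    by (subst pos_le_divide_eq) (simp_all add: mult_ac)
  then show ?thesis by (simp add: proximity_fun_def mult_ac)
qed

text \<open>The function \<open>S - ln |h|\<close> is harmonic and non-negative, so that its increments are at most the largest
increment of the Poisson kernel times its mean value on the circle, which is its value at 0.\<close>

lemma harnack_zero_free:
  fixes h :: "complex \<Rightarrow> complex"
  assumes h: "h holomorphic_on UNIV" and nz: "\<And>z. norm z \<le> R \<Longrightarrow> h z \<noteq> 0"
    and bd: "\<And>z. norm z = R \<Longrightarrow> norm (h z) \<le> exp S"
    and s: "s < R" "norm z \<le> s" "norm z' \<le> s"
  shows "ln (norm (h z')) - ln (norm (h z)) \<le> 2 * R * norm (z' - z) / (R - s)^2 * (S - ln (norm (h 0)))"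
proof -
  have R: "R > 0" using s norm_ge_zero[of z] by linarith
  let ?c = "2 * R * norm (z' - z) / (R - s)^2"
  let ?P = "\<lambda>z t. Re ((of_real R * cis t + z) / (of_real R * cis t - z))"
  let ?L = "\<lambda>t. ln (norm (h (of_real R * cis t)))"
  have zR: "norm z < R" "norm z' < R" using s by auto
  have P1: "(?P u has_integral 2 * pi) {0..2*pi}" if "norm u < R" for u
    using poisson_formula_ln_norm[of "\<lambda>_. exp 1" R u] that by auto
  have L: "((\<lambda>t. ?L t * ?P u t) has_integral 2 * pi * ln (norm (h u))) {0..2*pi}" if "norm u < R" for u
    using poisson_formula_ln_norm[OF h nz that] by auto
  have U: "((\<lambda>t. (S - ?L t) * ?P u t) has_integral 2 * pi * (S - ln (norm (h u)))) {0..2*pi}" if "norm u < R" for u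
    using has_integral_diff[OF has_integral_mult_right[OF P1[OF that], of S] L[OF that]]
    by (simp add: algebra_simps)
  have "((\<lambda>t. ?c * ((S - ?L t) * ?P 0 t)) has_integral ?c * (2 * pi * (S - ln (norm (h 0))))) {0..2*pi}"
    by (intro has_integral_mult_right U) (use R in auto)
  note right = this
  have left: "((\<lambda>t. (S - ?L t) * ?P z t - (S - ?L t) * ?P z' t) has_integral
      2 * pi * (S - ln (norm (h z))) - 2 * pi * (S - ln (norm (h z')))) {0..2*pi}"
    by (intro has_integral_diff U zR)
  have "2 * pi * (S - ln (norm (h z))) - 2 * pi * (S - ln (norm (h z'))) \<le> ?c * (2 * pi * (S - ln (norm (h 0))))"
  proof (rule has_integral_le[OF left right])
    fix t :: real
    define \<zeta> where "\<zeta> = of_real R * cis t"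
    have n: "norm \<zeta> = R" using R by (simp add: \<zeta>_def norm_mult)
    have ne: "\<zeta> \<noteq> z" "\<zeta> \<noteq> z'" "\<zeta> \<noteq> 0" using n zR R by auto
    have pos: "S - ln (norm (h \<zeta>)) \<ge> 0"
      using ln_mono[OF bd[OF n]] nz[of \<zeta>] n by simp
    have ge: "R - s \<le> norm (\<zeta> - z)" "R - s \<le> norm (\<zeta> - z')"
      using norm_triangle_ineq2[of \<zeta> z] norm_triangle_ineq2[of \<zeta> z'] n s by auto
    have "(\<zeta> + z) / (\<zeta> - z) - (\<zeta> + z') / (\<zeta> - z') = 2 * \<zeta> * (z - z') / ((\<zeta> - z) * (\<zeta> - z'))"
      using ne by (simp add: field_simps)
    then have "norm ((\<zeta> + z) / (\<zeta> - z) - (\<zeta> + z') / (\<zeta> - z')) = 2 * R * norm (z' - z) / (norm (\<zeta> - z) * norm (\<zeta> - z'))"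
      by (simp add: norm_mult norm_divide n norm_minus_commute)
    also have "\<dots> \<le> 2 * R * norm (z' - z) / ((R - s) * (R - s))"
      using ge s R by (intro divide_left_mono mult_mono mult_pos_pos) auto
    finally have "Re ((\<zeta> + z) / (\<zeta> - z)) - Re ((\<zeta> + z') / (\<zeta> - z')) \<le> ?c"
      by (smt (verit) complex_Re_le_cmod minus_complex.simps(1) power2_eq_square)
    then have "(S - ln (norm (h \<zeta>))) * (Re ((\<zeta> + z) / (\<zeta> - z)) - Re ((\<zeta> + z') / (\<zeta> - z'))) \<le> (S - ln (norm (h \<zeta>))) * ?c"
      by (intro mult_left_mono pos)
    moreover have "(\<zeta> + 0) / (\<zeta> - 0) = 1" using ne by simp
    ultimately have "(S - ln (norm (h \<zeta>))) * Re ((\<zeta> + z) / (\<zeta> - z)) - (S - ln (norm (h \<zeta>))) * Re ((\<zeta> + z') / (\<zeta> - z'))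
        \<le> ?c * ((S - ln (norm (h \<zeta>))) * Re ((\<zeta> + 0) / (\<zeta> - 0)))"
      by (simp add: algebra_simps)
    then show "(S - ?L t) * ?P z t - (S - ?L t) * ?P z' t \<le> ?c * ((S - ?L t) * ?P 0 t)"
      by (simp add: \<zeta>_def)
  qed
  then have "2 * pi * (ln (norm (h z')) - ln (norm (h z))) \<le> 2 * pi * (?c * (S - ln (norm (h 0))))"
    by (simp only: right_diff_distrib mult.left_commute[of ?c])
  then show ?thesis by (rule mult_left_le_imp_le) simp
qed

section \<open>Division by the zeros in a disc\<close>

lemma divide_out_zero:
  fixes g :: "complex \<Rightarrow> complex"
  assumes g: "g holomorphic_on UNIV" and "g a = 0" "a \<noteq> 0"
  obtains g' where "g' holomorphic_on UNIV" "\<And>z. g z = g' z * (1 - z / a)"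
proof -
  define q where "q z = (if z = a then deriv g a else g z / (z - a))" for z
  have "q holomorphic_on UNIV"
    by (rule pole_theorem_open_0[OF g]) (auto simp: q_def assms)
  moreover have "g z = (- a * q z) * (1 - z / a)" for z
    using assms by (cases "z = a") (auto simp: q_def field_simps)
  ultimately show ?thesis by (intro that[of "\<lambda>z. - a * q z"] holomorphic_intros) auto
qed

lemma norm_prod_list: "norm (\<Prod>x\<leftarrow>xs. g x) = (\<Prod>x\<leftarrow>xs. norm (g x))"
  for g :: "'a \<Rightarrow> 'b :: real_normed_field"
  by (induction xs) (auto simp: norm_mult)

lemma prod_list_mono_nonneg:
  fixes g h :: "'a \<Rightarrow> real"
  assumes "\<And>x. x \<in> set xs \<Longrightarrow> 0 \<le> g x" "\<And>x. x \<in> set xs \<Longrightarrow> g x \<le> h x"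
  shows "0 \<le> (\<Prod>x\<leftarrow>xs. g x) \<and> (\<Prod>x\<leftarrow>xs. g x) \<le> (\<Prod>x\<leftarrow>xs. h x)"
  using assms
proof (induction xs)
  case (Cons x xs)
  have "0 \<le> (\<Prod>x\<leftarrow>xs. g x) \<and> (\<Prod>x\<leftarrow>xs. g x) \<le> (\<Prod>x\<leftarrow>xs. h x)"
    using Cons by simp
  moreover have "0 \<le> g x" "g x \<le> h x" using Cons.prems by auto
  ultimately show ?case by (simp add: mult_mono)
qed simp

lemma holomorphic_prod_list:
  assumes "\<And>x. x \<in> set xs \<Longrightarrow> g x holomorphic_on S"
  shows "(\<lambda>z. \<Prod>x\<leftarrow>xs. g x z) holomorphic_on S"
  using assms by (induction xs) (auto intro!: holomorphic_intros)

text \<open>Every factor has modulus at least 2 on the circle of radius \<open>3R\<close>, hence \<open>|G| 2\<^bsup>length as\<^esup>\<close> is at most the modulus of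
the product there, and inside by the maximum principle. At \<open>z = 0\<close> this bounds the number of zeros.\<close>

lemma cofactor_bound:
  fixes G :: "complex \<Rightarrow> complex"
  assumes G: "G holomorphic_on UNIV" and as: "\<And>a. a \<in> set as \<Longrightarrow> a \<noteq> 0 \<and> norm a \<le> R"
    and bd: "\<And>z. norm z = 3 * R \<Longrightarrow> norm (G z * (\<Prod>a\<leftarrow>as. 1 - z / a)) \<le> B"
    and z: "norm z \<le> 3 * R"
  shows "norm (G z) * 2 ^ length as \<le> B"
proof -
  have "norm (G z * 2 ^ length as) \<le> B"
  proof (rule max_modulus_cball[OF _ _ z])
    show "(\<lambda>z. G z * 2 ^ length as) holomorphic_on UNIV" by (intro holomorphic_intros G)
    fix u :: complex assume u: "norm u = 3 * R"
    have "2 \<le> norm (1 - u / a)" if "a \<in> set as" for a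
    proof -
      have "3 \<le> norm (u / a)" using as[OF that] u by (simp add: norm_divide field_simps)
      then show ?thesis using norm_triangle_ineq2[of "u / a" 1] by (simp add: norm_minus_commute)
    qed
    then have "(\<Prod>a\<leftarrow>as. 2) \<le> (\<Prod>a\<leftarrow>as. norm (1 - u / a))"
      by (intro prod_list_mono_nonneg[THEN conjunct2]) auto
    moreover have "(\<Prod>a\<leftarrow>as. 2 :: real) = 2 ^ length as" by (induction as) auto
    ultimately have "2 ^ length as \<le> norm (\<Prod>a\<leftarrow>as. 1 - u / a)"
      by (simp add: norm_prod_list)
    then have "norm (G u * 2 ^ length as) \<le> norm (G u * (\<Prod>a\<leftarrow>as. 1 - u / a))"
      by (simp add: norm_mult norm_power mult_left_mono)
    then show "norm (G u * 2 ^ length as) \<le> B" using bd[OF u] by linarith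
  qed
  then show ?thesis by (simp add: norm_mult norm_power)
qed

text \<open>The possible lists of divided-out zeros have bounded length by \<open>cofactor_bound\<close>. A longest one leaves a
cofactor that is zero-free in the disc, since any remaining zero could be divided out as well.\<close>

lemma zero_factorization:
  fixes f :: "complex \<Rightarrow> complex"
  assumes f: "f holomorphic_on UNIV" and f0: "f 0 \<noteq> 0" and R: "R > 0"
  obtains as G where "G holomorphic_on UNIV" "\<And>z. f z = G z * (\<Prod>a\<leftarrow>as. 1 - z / a)"
    "\<And>a. a \<in> set as \<Longrightarrow> a \<noteq> 0 \<and> norm a \<le> R" "\<And>z. norm z \<le> R \<Longrightarrow> G z \<noteq> 0"
proof -
  define fac where "fac as G \<longleftrightarrow> G holomorphic_on UNIV \<and> (\<forall>z. f z = G z * (\<Prod>a\<leftarrow>as. 1 - z / a)) \<and>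
    (\<forall>a\<in>set as. a \<noteq> 0 \<and> norm a \<le> R)" for as G
  have "compact (f ` sphere 0 (3 * R))"
    by (intro compact_continuous_image holomorphic_on_imp_continuous_on holomorphic_on_subset[OF f]) auto
  then obtain B where B: "\<And>z. norm z = 3 * R \<Longrightarrow> norm (f z) \<le> B"
    using compact_imp_bounded[OF \<open>compact _\<close>] unfolding bounded_iff by fastforce
  have len: "length as < nat \<lceil>B / norm (f 0)\<rceil> + 1" if "\<exists>G. fac as G" for as
  proof -
    from that obtain G where G: "fac as G" by blast
    then have "norm (G 0) * 2 ^ length as \<le> B"
      using R B by (intro cofactor_bound[where R = R]) (auto simp: fac_def)
    moreover have "f 0 = G 0"
    proof -
      have "(\<Prod>a\<leftarrow>as. 1 - 0 / a) = (1 :: complex)" by (induction as) auto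
      then show ?thesis using G by (simp add: fac_def)
    qed
    ultimately have "2 ^ length as \<le> B / norm (f 0)"
      using f0 by (simp add: field_simps)
    moreover have "real (length as) < 2 ^ length as" by (rule of_nat_less_two_power)
    ultimately have "real (length as) < B / norm (f 0)" by linarith
    then show ?thesis by linarith
  qed
  have "\<exists>G. fac [] G" using f by (intro exI[of _ f]) (auto simp: fac_def)
  then obtain as where as: "\<exists>G. fac as G"
    and max: "\<And>bs. \<exists>G. fac bs G \<Longrightarrow> length bs \<le> length as"
    using ex_has_greatest_nat[of "\<lambda>as. \<exists>G. fac as G" "[]" length] len by blast
  from as obtain G where G: "fac as G" by blast
  have "G z \<noteq> 0" if z: "norm z \<le> R" for z
  proof
    assume Gz: "G z = 0"
    have "f z = 0" using G Gz by (auto simp: fac_def)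
    then have "z \<noteq> 0" using f0 by auto
    then obtain H where H: "H holomorphic_on UNIV" "\<And>u. G u = H u * (1 - u / z)"
      using divide_out_zero[of G z] G Gz unfolding fac_def by blast
    have "fac (z # as) H"
      using G H \<open>z \<noteq> 0\<close> z unfolding fac_def by (auto simp: mult_ac)
    then show False using max[of "z # as"] by auto
  qed
  then show ?thesis using that[of G as] G unfolding fac_def by blast
qed

text \<open>For a zero \<open>a\<close> in the disc, \<open>R - cnj a z/R\<close> is what remains of \<open>z - a\<close> after division by the Blaschke factor of
\<open>a\<close>: a zero-free function with the same modulus on the circle and at least the same modulus inside.\<close>

lemma blaschke_norm:
  fixes a z :: complex
  assumes "norm a < R" 
  shows "norm z = R \<Longrightarrow> norm (of_real R - cnj a * z / of_real R) = norm (z - a)"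
    and "norm z \<le> R \<Longrightarrow> norm (z - a) \<le> norm (of_real R - cnj a * z / of_real R)"
    and "norm z \<le> R \<Longrightarrow> of_real R - cnj a * z / of_real R \<noteq> 0"
proof -
  have R: "R > 0" using assms norm_ge_zero[of a] by linarith
  have key: "(norm (of_real R - cnj a * z / of_real R))^2 - (norm (z - a))^2 = (R^2 - (norm a)^2) * (R^2 - (norm z)^2) / R^2"
  proof -
    define w where "w = cnj a * z"
    have "(norm (of_real R - w / of_real R))^2 = (R - Re w / R)^2 + (Im w / R)^2"
      by (simp only: cmod_power2 minus_complex.sel Re_complex_of_real Im_complex_of_real Re_divide_of_real Im_divide_of_real) simp
    also have "\<dots> = R^2 - 2 * Re w + (norm w)^2 / R^2"
      using R unfolding cmod_power2 by (simp add: power2_eq_square field_simps)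
    also have "(norm w)^2 = (norm a)^2 * (norm z)^2"
      by (simp add: w_def norm_mult power_mult_distrib)
    finally have 1: "(norm (of_real R - w / of_real R))^2 = R^2 - 2 * Re w + (norm a)^2 * (norm z)^2 / R^2" .
    have 2: "(norm (z - a))^2 = (norm z)^2 + (norm a)^2 - 2 * Re w"
      unfolding w_def
      by (simp only: cmod_power2 minus_complex.sel times_complex.sel cnj.sel) (simp add: power2_eq_square algebra_simps)
    have 3: "(R^2 - (norm a)^2) * (R^2 - (norm z)^2) / R^2 = R^2 - (norm z)^2 - (norm a)^2 + (norm a)^2 * (norm z)^2 / R^2"
      using R by (simp add: power2_eq_square field_simps)
    show ?thesis using 1 2 3 unfolding w_def by linarith
  qed
  show "norm (of_real R - cnj a * z / of_real R) = norm (z - a)" if "norm z = R"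
  proof (rule power2_eq_imp_eq)
    have "(R^2 - (norm a)^2) * (R^2 - (norm z)^2) / R^2 = 0" by (simp only: that) simp
    then show "(norm (of_real R - cnj a * z / of_real R))^2 = (norm (z - a))^2"
      using key by linarith
  qed simp_all
  show "norm (z - a) \<le> norm (of_real R - cnj a * z / of_real R)" if "norm z \<le> R"
  proof -
    have "(R^2 - (norm a)^2) * (R^2 - (norm z)^2) / R^2 \<ge> 0"
    proof (intro divide_nonneg_nonneg mult_nonneg_nonneg)
      show "0 \<le> R^2 - (norm a)^2" using power_mono[of "norm a" R 2] assms by simp
      show "0 \<le> R^2 - (norm z)^2" using power_mono[of "norm z" R 2] that by simp
    qed simp
    then have "(norm (z - a))^2 \<le> (norm (of_real R - cnj a * z / of_real R))^2" using key by linarith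
    then show ?thesis by (rule power2_le_imp_le) simp
  qed
  show "of_real R - cnj a * z / of_real R \<noteq> 0" if "norm z \<le> R"
  proof
    assume "of_real R - cnj a * z / of_real R = 0"
    then have "cnj a * z = of_real (R^2)" using R by (simp add: field_simps power2_eq_square)
    then have "norm (cnj a * z) = R^2" by (metis abs_of_nonneg norm_of_real zero_le_power2)
    moreover have "norm (cnj a * z) \<le> norm a * R" using that by (simp add: norm_mult mult_left_mono)
    moreover have "norm a * R < R^2" using assms R by (simp add: power2_eq_square)
    ultimately show False by linarith
  qed
qed

section \<open>Growth of an entire function of finite order\<close>

lemma proximity_fun_nonneg: assumes "f holomorphic_on UNIV" shows "proximity_fun f R \<ge> 0"
proof -
  have "continuous_on {0..2*pi} (\<lambda>t. log_plus (norm (f (of_real R * cis t))))"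
    unfolding log_plus_def
    by (intro continuous_intros continuous_on_compose2[OF holomorphic_on_imp_continuous_on[OF assms]]) auto
  then have "0 \<le> integral {0..2*pi} (\<lambda>t. log_plus (norm (f (of_real R * cis t))))"
    by (intro integral_nonneg integrable_continuous_real) (auto simp: log_plus_def)
  then show ?thesis by (simp add: proximity_fun_def)
qed

text \<open>Replacing every factor that vanishes inside the circle by its Blaschke partner produces a zero-free \<open>h\<close> with
\<open>|h| = |f|\<close> on the circle and \<open>|f| \<le> |h|\<close> inside, to which \<open>ln_norm_le_proximity\<close> applies. The radius \<open>R\<close> is left
free in an interval so that zeros on the circle itself can be avoided. For \<open>|z| \<le> r\<close> and \<open>R \<ge> 2r\<close> the quotient
\<open>(R + |z|)/(R - |z|)\<close> is at most 3.\<close>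

lemma norm_le_exp_proximity:
  fixes f :: "complex \<Rightarrow> complex"
  assumes f: "f holomorphic_on UNIV" and f0: "f 0 \<noteq> 0" and r: "r > 0"
  obtains R where "2 * r \<le> R" "R \<le> 3 * r" "\<And>z. norm z \<le> r \<Longrightarrow> norm (f z) \<le> exp (3 * proximity_fun f R)"
proof -
  obtain as G where G: "G holomorphic_on UNIV" "\<And>z. f z = G z * (\<Prod>a\<leftarrow>as. 1 - z / a)"
    "\<And>a. a \<in> set as \<Longrightarrow> a \<noteq> 0 \<and> norm a \<le> 3 * r" "\<And>z. norm z \<le> 3 * r \<Longrightarrow> G z \<noteq> 0"
    using zero_factorization[OF f f0, of "3 * r"] r by (metis mult_pos_pos zero_less_numeral)
  have "infinite {2*r<..<3*r}" using r by (simp add: infinite_Ioo)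
  then have "\<not> {2*r<..<3*r} \<subseteq> norm ` set as" using finite_subset by blast
  then obtain R where R: "2 * r < R" "R < 3 * r" "R \<notin> norm ` set as"
    unfolding subset_iff greaterThanLessThan_iff by blast
  define \<beta> where "\<beta> a z = (if norm a < R then (of_real R - cnj a * z / of_real R) / (- a) else 1 - z / a)" for a z
  define h where "h z = G z * (\<Prod>a\<leftarrow>as. \<beta> a z)" for z
  have factor: "1 - z / a = (z - a) / (- a)" if "a \<noteq> 0" for a z :: complex using that by (simp add: diff_divide_distrib)
  have b1: "norm (1 - z / a) \<le> norm (\<beta> a z)" if "a \<in> set as" "norm z \<le> R" for a z
    using blaschke_norm(2)[of a R z] that G(3)[OF that(1)] factor[of a z]
    by (auto simp: \<beta>_def norm_divide divide_right_mono)
  have b2: "norm (\<beta> a z) = norm (1 - z / a)" if "a \<in> set as" "norm z = R" for a z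
    using blaschke_norm(1)[of a R z] that G(3)[OF that(1)] factor[of a z]
    by (auto simp: \<beta>_def norm_divide)
  have b3: "\<beta> a z \<noteq> 0" if "a \<in> set as" "norm z \<le> R" for a z
  proof (cases "norm a < R")
    case True
    then show ?thesis using blaschke_norm(3)[of a R z] that G(3)[OF that(1)] by (auto simp: \<beta>_def)
  next
    case False
    then have "norm a > R" using R(3) that by force
    then have "z \<noteq> a" using that by auto
    then show ?thesis using False G(3)[OF that(1)] by (simp add: \<beta>_def)
  qed
  have h: "h holomorphic_on UNIV" unfolding h_def
  proof (intro holomorphic_intros G(1) holomorphic_prod_list)
    fix a assume "a \<in> set as"
    then show "\<beta> a holomorphic_on UNIV" using G(3) R r unfolding \<beta>_def
      by (cases "norm a < R") (auto intro!: holomorphic_intros)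
  qed
  have hnz: "h z \<noteq> 0" if "norm z \<le> R" for z
    using G(4)[of z] that R b3 unfolding h_def by (auto simp: prod_list_zero_iff)
  have eq: "norm (h z) = norm (f z)" if "norm z = R" for z
  proof -
    have "map (\<lambda>a. norm (\<beta> a z)) as = map (\<lambda>a. norm (1 - z / a)) as" using b2[OF _ that] by simp
    then show ?thesis unfolding h_def G(2) norm_mult norm_prod_list by presburger
  qed
  have prox: "proximity_fun h R = proximity_fun f R"
    unfolding proximity_fun_def using R r by (simp add: eq norm_mult)
  show ?thesis
  proof (rule that[of R])
    fix z :: complex assume z: "norm z \<le> r"
    then have zR: "norm z < R" using R r by linarith
    have "(\<Prod>a\<leftarrow>as. norm (1 - z / a)) \<le> (\<Prod>a\<leftarrow>as. norm (\<beta> a z))"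
      using b1 zR by (intro prod_list_mono_nonneg[THEN conjunct2]) auto
    then have "norm (f z) \<le> norm (h z)"
      unfolding G(2)[of z] h_def norm_mult norm_prod_list by (intro mult_left_mono) auto
    also have "norm (h z) = exp (ln (norm (h z)))" using hnz[of z] zR by simp
    also have "\<dots> \<le> exp (3 * proximity_fun f R)"
    proof -
      have "ln (norm (h z)) \<le> (R + norm z) / (R - norm z) * proximity_fun h R"
        by (rule ln_norm_le_proximity[OF h hnz zR])
      also have "\<dots> \<le> 3 * proximity_fun h R"
        using z R r proximity_fun_nonneg[OF h] by (intro mult_right_mono) (auto simp: field_simps)
      finally show ?thesis using prox by simp
    qed
    finally show "norm (f z) \<le> exp (3 * proximity_fun f R)" .
  qed (use R in auto)
qed

lemma nevanlinna_char_entire: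
  assumes "f holomorphic_on UNIV"
  shows "nevanlinna_char f r = proximity_fun f r"
proof -
  have "\<not> is_pole f z" for z
    using not_is_pole_holomorphic[of UNIV z f] assms by simp
  then have "pole_count f t = 0" for t by (simp add: pole_count_def)
  then show ?thesis by (simp add: nevanlinna_char_def pole_counting_fun_def)
qed

lemma finite_order_proximity:
  assumes f: "f holomorphic_on UNIV" and fo: "finite_order f"
  obtains N :: nat and r0 where "r0 \<ge> 1" "\<And>r. r \<ge> r0 \<Longrightarrow> proximity_fun f r \<le> r ^ N"
proof -
  obtain M :: real where M: "growth_order f < ereal M"
    using fo less_PInf_Ex_of_nat[of "growth_order f"] unfolding finite_order_def by auto
  have "eventually (\<lambda>r. ereal (log_plus (nevanlinna_char f r) / ln r) < ereal M) at_top"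
    using M unfolding growth_order_def by (rule Limsup_lessD)
  then obtain r1 where r1: "\<And>r. r \<ge> r1 \<Longrightarrow> log_plus (nevanlinna_char f r) / ln r < M"
    by (auto simp: eventually_at_top_linorder)
  have "proximity_fun f r \<le> r ^ nat \<lceil>M\<rceil>" if r: "r \<ge> max r1 2" for r
  proof -
    have "log_plus (proximity_fun f r) \<le> M * ln r"
      using r1[of r] r by (simp add: nevanlinna_char_entire[OF f] field_simps)
    also have "\<dots> \<le> real (nat \<lceil>M\<rceil>) * ln r"
      using r by (intro mult_right_mono real_nat_ceiling_ge) auto
    also have "\<dots> = ln (r ^ nat \<lceil>M\<rceil>)" using r by (simp add: ln_realpow)
    finally have "max 1 (proximity_fun f r) \<le> r ^ nat \<lceil>M\<rceil>"
      using r unfolding log_plus_def by (subst (asm) ln_le_cancel_iff) auto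
    then show ?thesis by simp
  qed
  then show ?thesis using that[of "max r1 2" "nat \<lceil>M\<rceil>"] by auto
qed

text \<open>Passing from \<open>f\<close> to \<open>f + 1\<close> ensures a non-zero value at 0 at the cost of a bounded term.\<close>

lemma proximity_fun_add_one:
  assumes f: "f holomorphic_on UNIV"
  shows "proximity_fun (\<lambda>z. f z + 1) r \<le> proximity_fun f r + ln 2"
proof -
  have c: "continuous_on {0..2*pi} (\<lambda>t. log_plus (norm (g (of_real r * cis t))))" if "g holomorphic_on UNIV" for g
    unfolding log_plus_def
    by (intro continuous_intros continuous_on_compose2[OF holomorphic_on_imp_continuous_on[OF that]]) auto
  have le: "log_plus (norm (w + 1)) \<le> log_plus (norm w) + ln 2" for w :: complex
  proof -
    have "max 1 (norm (w + 1)) \<le> max 1 (norm w) * 2"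
      using norm_triangle_ineq[of w 1] by (auto simp: max_def)
    then have "ln (max 1 (norm (w + 1))) \<le> ln (max 1 (norm w) * 2)" by (subst ln_le_cancel_iff) auto
    also have "\<dots> = ln (max 1 (norm w)) + ln 2" by (subst ln_mult) auto
    finally show ?thesis by (simp add: log_plus_def)
  qed
  have "integral {0..2*pi} (\<lambda>t. log_plus (norm (f (of_real r * cis t) + 1)))
      \<le> integral {0..2*pi} (\<lambda>t. log_plus (norm (f (of_real r * cis t))) + ln 2)"
    by (intro integral_le integrable_continuous_real c continuous_intros le) (intro holomorphic_intros f)+
  also have "\<dots> = integral {0..2*pi} (\<lambda>t. log_plus (norm (f (of_real r * cis t)))) + 2 * pi * ln 2"
    by (subst Henstock_Kurzweil_Integration.integral_add)
       (auto intro!: integrable_continuous_real c f)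
  finally show ?thesis by (simp add: proximity_fun_def field_simps)
qed

lemma finite_order_growth:
  assumes f: "f holomorphic_on UNIV" and fo: "finite_order f"
  obtains N :: nat and K :: real where "K \<ge> 0" "\<And>z. norm (f z) \<le> exp (K * (1 + norm z) ^ N)"
proof -
  obtain N r0 where N: "r0 \<ge> 1" "\<And>r. r \<ge> r0 \<Longrightarrow> proximity_fun f r \<le> r ^ N"
    using finite_order_proximity[OF f fo] by metis
  define g where "g = (if f 0 = 0 then (\<lambda>z. f z + 1) else f)"
  have g: "g holomorphic_on UNIV" "g 0 \<noteq> 0"
    using f holomorphic_on_add[OF f holomorphic_on_const, of 1] by (auto simp: g_def)
  have gp: "proximity_fun g r \<le> r ^ N + 1" if "r \<ge> r0" for r
    using N(2)[OF that] proximity_fun_add_one[OF f, of r] ln_2_less_1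
    by (cases "f 0 = 0") (simp_all add: g_def)
  have gb: "norm (g z) \<le> exp (3 * ((3 * (r0 + norm z)) ^ N + 1))" for z
  proof -
    have "r0 + norm z > 0" using N(1) norm_ge_zero[of z] by linarith
    then obtain R where R: "2 * (r0 + norm z) \<le> R" "R \<le> 3 * (r0 + norm z)"
      "\<And>u. norm u \<le> r0 + norm z \<Longrightarrow> norm (g u) \<le> exp (3 * proximity_fun g R)"
      using norm_le_exp_proximity[OF g] by blast
    have "r0 + norm z \<le> R" using R(1) \<open>r0 + norm z > 0\<close> unfolding mult_2 by linarith
    then have "R \<ge> r0" using norm_ge_zero[of z] by linarith
    then have "proximity_fun g R \<le> R ^ N + 1" by (rule gp)
    moreover have "R ^ N \<le> (3 * (r0 + norm z)) ^ N" using R(2) \<open>R \<ge> r0\<close> N(1) by (intro power_mono) auto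
    ultimately have "exp (3 * proximity_fun g R) \<le> exp (3 * ((3 * (r0 + norm z)) ^ N + 1))" by simp
    moreover have "norm (g z) \<le> exp (3 * proximity_fun g R)" using R(3)[of z] N(1) by simp
    ultimately show ?thesis by linarith
  qed
  define K where "K = 3 * (3 * r0) ^ N + 4"
  show ?thesis
  proof (rule that[of K N])
    show "K \<ge> 0" using N(1) by (simp add: K_def)
    fix z :: complex
    have one: "1 \<le> (1 + norm z) ^ N" by simp
    have "3 * (r0 + norm z) \<le> 3 * r0 * (1 + norm z)" using mult_right_mono[OF N(1), of "norm z"]
      unfolding distrib_left by simp
    then have "(3 * (r0 + norm z)) ^ N \<le> (3 * r0 * (1 + norm z)) ^ N"
      using N(1) by (intro power_mono) auto
    then have e: "(3 * (r0 + norm z)) ^ N \<le> (3 * r0) ^ N * (1 + norm z) ^ N" by (simp add: power_mult_distrib)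
    have "norm (f z) \<le> norm (g z) + 1"
      using norm_triangle_ineq4[of "f z + 1" 1] by (auto simp: g_def)
    also have "\<dots> \<le> 2 * exp (3 * ((3 * (r0 + norm z)) ^ N + 1))"
    proof -
      have "0 \<le> (3 * (r0 + norm z)) ^ N" using N(1) by (intro zero_le_power mult_nonneg_nonneg) auto
      then have "1 \<le> exp (3 * ((3 * (r0 + norm z)) ^ N + 1))" by simp
      then show ?thesis using gb[of z] by linarith
    qed
    also have "\<dots> \<le> exp 1 * exp (3 * ((3 * (r0 + norm z)) ^ N + 1))"
      using exp_ge_add_one_self[of 1] by (intro mult_right_mono) auto
    also have "\<dots> = exp (3 * (3 * (r0 + norm z)) ^ N + 4)" by (simp flip: exp_add)
    also have "\<dots> \<le> exp (K * (1 + norm z) ^ N)"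
    proof -
      have "K * (1 + norm z) ^ N = 3 * ((3 * r0) ^ N * (1 + norm z) ^ N) + 4 * (1 + norm z) ^ N"
        unfolding K_def by (simp only: distrib_right mult.assoc)
      then have "3 * (3 * (r0 + norm z)) ^ N + 4 \<le> K * (1 + norm z) ^ N" using e one by linarith
      then show ?thesis by simp
    qed
    finally show "norm (f z) \<le> exp (K * (1 + norm z) ^ N)" .
  qed
qed

lemma norm_higher_deriv_le:
  fixes f :: "complex \<Rightarrow> complex"
  assumes f: "f holomorphic_on UNIV" and bd: "\<And>u. norm (u - z) \<le> 1 \<Longrightarrow> norm (f u) \<le> B"
  shows "norm ((deriv ^^ k) f z) \<le> fact k * B"
proof -
  have "norm ((deriv ^^ k) f z) \<le> fact k * B / 1 ^ k"
    by (rule Cauchy_inequality)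
       (use f bd in \<open>auto intro: holomorphic_on_subset holomorphic_on_imp_continuous_on simp: norm_minus_commute\<close>)
  then show ?thesis by simp
qed

text \<open>The step hypothesis improves a bound \<open>T\<close> for \<open>\<phi>\<close> on a slightly larger disc by a factor \<open>1/n\<close>. The affine function
in the conclusion reproduces itself under this step, while the a priori bound, evaluated after \<open>m\<close> steps at
distance \<open>|z| + md\<close> and divided by \<open>n\<^sup>m\<close>, tends to 0.\<close>

lemma affine_growth_iteration:
  fixes n N :: nat and \<phi> :: "complex \<Rightarrow> real"
  assumes n: "n \<ge> 2" and A: "A \<ge> 0" and B: "B \<ge> 0" and d: "d \<ge> 0" and K: "K \<ge> 0"
    and a_priori: "\<And>z. \<phi> z \<le> K * (1 + norm z) ^ N"
    and step: "\<And>z T. T \<ge> 0 \<Longrightarrow> (\<And>u. norm u \<le> norm z + d \<Longrightarrow> \<phi> u \<le> T) \<Longrightarrow> real n * \<phi> z \<le> A * norm z + B + T"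
  shows "\<phi> z \<le> A * norm z + (B + A * d)"
proof -
  define C where "C = B + A * d"
  have C: "C \<ge> 0" using A B d by (simp add: C_def)
  have iter: "\<phi> z \<le> A * norm z + C + K * (1 + norm z + real m * d) ^ N / real n ^ m" for m z
  proof (induction m arbitrary: z)
    case 0
    have "0 \<le> A * norm z + C" using A C by simp
    then show ?case using a_priori[of z] by simp
  next
    case (Suc m)
    let ?T = "A * (norm z + d) + C + K * (1 + norm z + real (Suc m) * d) ^ N / real n ^ m"
    have "?T \<ge> 0" using A C K d by (intro add_nonneg_nonneg mult_nonneg_nonneg divide_nonneg_nonneg) auto
    moreover have "\<phi> u \<le> ?T" if u: "norm u \<le> norm z + d" for u
    proof -
      have "(1 + norm u + real m * d) ^ N \<le> (1 + norm z + real (Suc m) * d) ^ N"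
        using u d by (intro power_mono) (auto simp: algebra_simps)
      then have "K * (1 + norm u + real m * d) ^ N / real n ^ m \<le> K * (1 + norm z + real (Suc m) * d) ^ N / real n ^ m"
        using K by (intro divide_right_mono mult_left_mono) auto
      moreover have "A * norm u \<le> A * (norm z + d)" using u A by (rule mult_left_mono)
      ultimately show ?thesis using Suc.IH[of u] by linarith
    qed
    ultimately have "real n * \<phi> z \<le> A * norm z + B + ?T" by (rule step)
    also have "\<dots> = 2 * (A * norm z + C) + K * (1 + norm z + real (Suc m) * d) ^ N / real n ^ m"
      by (simp add: C_def algebra_simps)
    also have "2 * (A * norm z + C) \<le> real n * (A * norm z + C)"
      using n A C by (intro mult_right_mono) auto
    finally have "real n * \<phi> z \<le> real n * (A * norm z + C + K * (1 + norm z + real (Suc m) * d) ^ N / real n ^ Suc m)"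
      using n by (simp add: distrib_left)
    then show ?case using n by (subst (asm) mult_le_cancel_left_pos) auto
  qed
  have lim: "(\<lambda>m. K * ((1 + norm z + real m * d) ^ N / real n ^ m)) \<longlonglongrightarrow> K * 0"
  proof (intro tendsto_mult tendsto_const)
    have "(\<lambda>m. (real m + 1) ^ N / real n ^ m) \<longlonglongrightarrow> 0"
      using n by real_asymp
    then have lim0: "(\<lambda>m. (1 + norm z + d) ^ N * ((real m + 1) ^ N / real n ^ m)) \<longlonglongrightarrow> 0"
      by (rule tendsto_mult_right_zero)
    show "(\<lambda>m. (1 + norm z + real m * d) ^ N / real n ^ m) \<longlonglongrightarrow> 0"
    proof (rule Lim_null_comparison[OF always_eventually lim0], rule allI)
      fix m
      have "1 + norm z + real m * d \<le> (1 + norm z + d) * (real m + 1)"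
        using d by (simp add: algebra_simps)
      then have "(1 + norm z + real m * d) ^ N \<le> ((1 + norm z + d) * (real m + 1)) ^ N"
        using d by (intro power_mono) auto
      then have "(1 + norm z + real m * d) ^ N / real n ^ m \<le> ((1 + norm z + d) * (real m + 1)) ^ N / real n ^ m"
        by (rule divide_right_mono) simp
      then show "norm ((1 + norm z + real m * d) ^ N / real n ^ m) \<le> (1 + norm z + d) ^ N * ((real m + 1) ^ N / real n ^ m)"
        using d by (simp add: power_mult_distrib)
    qed
  qed
  have "(\<lambda>m. A * norm z + C + K * (1 + norm z + real m * d) ^ N / real n ^ m) \<longlonglongrightarrow> A * norm z + C + 0"
    using lim by (intro tendsto_add tendsto_const) simp
  then have "\<phi> z \<le> A * norm z + C + 0"
    by (rule LIMSEQ_le_const) (use iter in auto)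
  then show ?thesis by (simp add: C_def)
qed

text \<open>The function \<open>F = f\<^sup>n e\<^bsup>\<mu>z\<^esup>\<close> with \<open>\<mu> = n/w\<close> is an antiderivative of \<open>\<mu> e\<^bsup>\<mu>z\<^esup> (P - L)\<close>, where \<open>L\<close> is the term with the shift.
Estimating it along radii bounds \<open>|f|\<^sup>n\<close> by the first power of the maximum of \<open>|f|\<close> on a slightly larger
disc, up to an exponential factor, which is the situation of \<open>affine_growth_iteration\<close>.\<close>

lemma equation_exponential_type:
  fixes f :: "complex \<Rightarrow> complex" and n k :: nat
  assumes n: "n \<ge> 2" and w: "w \<noteq> 0"
    and f: "f holomorphic_on UNIV" and fo: "finite_order f"
    and eq: "\<And>z. f z ^ n + w * f z ^ (n - 1) * deriv f z + (deriv ^^ k) f (z + c)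
               = p1 * exp (\<alpha>1 * z) + p2 * exp (\<alpha>2 * z)"
  obtains A B where "A \<ge> 0" "B \<ge> 0" "\<And>z. norm (f z) \<le> exp (A * norm z + B)"
proof -
  obtain N :: nat and K where K: "K \<ge> 0" "\<And>z. norm (f z) \<le> exp (K * (1 + norm z) ^ N)"
    using finite_order_growth[OF f fo] by metis
  define \<mu> where "\<mu> = of_nat n / w"
  define d where "d = norm c + 1"
  \<comment> \<open>\<open>2 * A0 + 1\<close> and \<open>ln Q\<close> are the slope and the constant in the growth inequality for \<open>log\<^sup>+ |f|\<close>\<close>
  define A0 where "A0 = norm \<mu> + norm \<alpha>1 + norm \<alpha>2"
  define Q0 where "Q0 = norm \<mu> * (norm p1 + norm p2 + fact k)"
  define Q where "Q = 1 + norm (f 0) ^ n + Q0"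
  have A0: "A0 \<ge> 0" and Q0: "Q0 \<ge> 0" by (auto simp: A0_def Q0_def)
  then have Q1: "Q \<ge> 1" by (simp add: Q_def)
  define F where "F t = f t ^ n * exp (\<mu> * t)" for t
  have F': "(F has_field_derivative \<mu> * exp (\<mu> * t) * (p1 * exp (\<alpha>1 * t) + p2 * exp (\<alpha>2 * t) - (deriv ^^ k) f (t + c))) (at t)" for t
  proof -
    have "(f has_field_derivative deriv f t) (at t)"
      using f by (simp add: holomorphic_derivI)
    then have "(F has_field_derivative of_nat n * f t ^ (n - 1) * deriv f t * exp (\<mu> * t) + f t ^ n * (\<mu> * exp (\<mu> * t))) (at t)"
      unfolding F_def by (auto intro!: derivative_eq_intros simp: algebra_simps)
    moreover have "p1 * exp (\<alpha>1 * t) + p2 * exp (\<alpha>2 * t) - (deriv ^^ k) f (t + c) = f t ^ n + w * f t ^ (n - 1) * deriv f t"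
      using eq[of t] by (simp add: algebra_simps)
    ultimately show ?thesis using w by (simp add: \<mu>_def field_simps)
  qed
  define \<phi> where "\<phi> z = log_plus (norm (f z))" for z
  have phi_le: "\<phi> z \<le> Y \<longleftrightarrow> norm (f z) \<le> exp Y" if "Y \<ge> 0" for z Y
  proof -
    have "\<phi> z \<le> Y \<longleftrightarrow> max 1 (norm (f z)) \<le> exp Y"
      unfolding \<phi>_def log_plus_def by (subst exp_le_cancel_iff[symmetric], subst exp_ln) auto
    then show ?thesis using that by simp
  qed
  have main: "real n * \<phi> z \<le> (2 * A0 + 1) * norm z + ln Q + T"
    if T: "T \<ge> 0" and bd: "\<And>u. norm u \<le> norm z + d \<Longrightarrow> \<phi> u \<le> T" for z T
  proof -
    have der: "norm (\<mu> * exp (\<mu> * t) * (p1 * exp (\<alpha>1 * t) + p2 * exp (\<alpha>2 * t) - (deriv ^^ k) f (t + c)))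
        \<le> Q0 * exp (A0 * norm z + T)" if t: "t \<in> cball 0 (norm z)" for t
    proof -
      have ex: "norm (exp (b * t)) \<le> exp (norm b * norm z)" for b
        using norm_exp[of "b * t"] t by (smt (verit, best) exp_le_cancel_iff mem_cball_0 mult_left_mono norm_ge_zero norm_mult)
      have ex': "norm (exp (b * t)) \<le> exp ((norm \<alpha>1 + norm \<alpha>2) * norm z + T)"
        if "norm b \<le> norm \<alpha>1 + norm \<alpha>2" for b
        using ex[of b] mult_right_mono[OF that norm_ge_zero[of z]] T
        by (meson add_increasing2 exp_le_cancel_iff order_trans)
      have "norm ((deriv ^^ k) f (t + c)) \<le> fact k * exp T"
      proof (rule norm_higher_deriv_le[OF f])
        fix u assume "norm (u - (t + c)) \<le> 1"
        then have "norm u \<le> norm z + d"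
          using t norm_triangle_ineq[of "u - (t + c)" "t + c"] norm_triangle_ineq[of t c] by (simp add: d_def)
        then show "norm (f u) \<le> exp T" using bd phi_le[OF T] by blast
      qed
      moreover have "norm (p1 * exp (\<alpha>1 * t)) \<le> norm p1 * exp ((norm \<alpha>1 + norm \<alpha>2) * norm z + T)"
        unfolding norm_mult by (intro mult_left_mono ex') auto
      moreover have "norm (p2 * exp (\<alpha>2 * t)) \<le> norm p2 * exp ((norm \<alpha>1 + norm \<alpha>2) * norm z + T)"
        unfolding norm_mult by (intro mult_left_mono ex') auto
      moreover have "fact k * exp T \<le> fact k * exp ((norm \<alpha>1 + norm \<alpha>2) * norm z + T)" by simp
      ultimately have "norm (p1 * exp (\<alpha>1 * t) + p2 * exp (\<alpha>2 * t) - (deriv ^^ k) f (t + c))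
         \<le> (norm p1 + norm p2 + fact k) * exp ((norm \<alpha>1 + norm \<alpha>2) * norm z + T)"
        using norm_triangle_ineq4[of "p1 * exp (\<alpha>1 * t) + p2 * exp (\<alpha>2 * t)" "(deriv ^^ k) f (t + c)"]
          norm_triangle_ineq[of "p1 * exp (\<alpha>1 * t)" "p2 * exp (\<alpha>2 * t)"]
        unfolding distrib_right by linarith
      then have "norm (\<mu> * exp (\<mu> * t) * (p1 * exp (\<alpha>1 * t) + p2 * exp (\<alpha>2 * t) - (deriv ^^ k) f (t + c)))
        \<le> norm \<mu> * exp (norm \<mu> * norm z) * ((norm p1 + norm p2 + fact k) * exp ((norm \<alpha>1 + norm \<alpha>2) * norm z + T))"
        unfolding norm_mult using ex[of \<mu>] by (intro mult_mono) auto
      also have "\<dots> = Q0 * (exp (norm \<mu> * norm z) * exp ((norm \<alpha>1 + norm \<alpha>2) * norm z + T))"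
        by (simp add: Q0_def)
      also have "\<dots> = Q0 * exp (A0 * norm z + T)"
        unfolding exp_add[symmetric] by (simp add: A0_def algebra_simps)
      finally show ?thesis .
    qed
    have "norm (F z - F 0) \<le> Q0 * exp (A0 * norm z + T) * norm (z - 0)"
      by (rule field_differentiable_bound[OF convex_cball[of 0 "norm z"] has_field_derivative_at_within[OF F'] der])
         auto
    then have "norm (F z) \<le> norm (f 0) ^ n + Q0 * exp (A0 * norm z + T) * norm z"
      using norm_triangle_ineq2[of "F z" "F 0"] by (simp add: F_def norm_power norm_mult)
    also have "\<dots> \<le> norm (f 0) ^ n * exp (A0 * norm z + T + norm z) + Q0 * exp (A0 * norm z + T) * exp (norm z)"
    proof -
      have "norm z \<le> exp (norm z)" using exp_ge_add_one_self[of "norm z"] by linarith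
      then have "Q0 * exp (A0 * norm z + T) * norm z \<le> Q0 * exp (A0 * norm z + T) * exp (norm z)"
        using Q0 by (intro mult_left_mono) auto
      moreover have "norm (f 0) ^ n * 1 \<le> norm (f 0) ^ n * exp (A0 * norm z + T + norm z)"
        using A0 T by (intro mult_left_mono) auto
      ultimately show ?thesis by simp
    qed
    also have "\<dots> \<le> Q * exp (A0 * norm z + T + norm z)"
      by (simp add: Q_def algebra_simps exp_add)
    finally have Fz: "norm (F z) \<le> Q * exp (A0 * norm z + T + norm z)" .
    have "f z ^ n = F z * exp (- \<mu> * z)" by (simp add: F_def exp_minus)
    then have "norm (f z) ^ n = norm (F z) * norm (exp (- \<mu> * z))" by (metis norm_mult norm_power)
    also have "norm (exp (- \<mu> * z)) \<le> exp (A0 * norm z)"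
    proof -
      have "norm (exp (- \<mu> * z)) \<le> exp (norm (- \<mu> * z))" by (rule norm_exp)
      also have "norm (- \<mu> * z) \<le> A0 * norm z" unfolding norm_mult norm_minus_cancel
        by (intro mult_right_mono) (auto simp: A0_def)
      finally show ?thesis by simp
    qed
    finally have "norm (f z) ^ n \<le> Q * exp (A0 * norm z + T + norm z) * exp (A0 * norm z)"
      using Fz by (meson exp_ge_zero mult_left_mono mult_right_mono norm_ge_zero order_trans)
    also have "\<dots> = Q * exp ((2 * A0 + 1) * norm z + T)"
      by (simp add: mult.assoc algebra_simps flip: exp_add)
    finally have fz: "norm (f z) ^ n \<le> Q * exp ((2 * A0 + 1) * norm z + T)" .
    show ?thesis
    proof (cases "norm (f z) \<le> 1")
      case True
      then have "\<phi> z = 0" by (simp add: \<phi>_def log_plus_def max_def)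
      then show ?thesis using A0 Q1 T by simp
    next
      case False
      then have "real n * \<phi> z = ln (norm (f z) ^ n)"
        by (simp add: \<phi>_def log_plus_def ln_realpow)
      also have "\<dots> \<le> ln (Q * exp ((2 * A0 + 1) * norm z + T))"
        using False by (intro ln_mono[OF fz] zero_less_power) linarith
      also have "\<dots> = ln Q + ((2 * A0 + 1) * norm z + T)" using Q1 by (subst ln_mult) auto
      finally show ?thesis by simp
    qed
  qed
  have phi: "\<phi> z \<le> (2 * A0 + 1) * norm z + (ln Q + (2 * A0 + 1) * d)" for z
  proof (rule affine_growth_iteration[OF n])
    show "\<phi> z \<le> K * (1 + norm z) ^ N" for z using phi_le K by simp
  qed (use A0 Q1 K(1) main in \<open>auto simp: d_def\<close>)
  show ?thesis
  proof (rule that)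
    show "2 * A0 + 1 \<ge> 0" "ln Q + (2 * A0 + 1) * d \<ge> 0" using A0 Q1 by (auto simp: d_def)
    then show "norm (f z) \<le> exp ((2 * A0 + 1) * norm z + (ln Q + (2 * A0 + 1) * d))" for z
      using phi[of z] by (subst phi_le[symmetric]) auto
  qed
qed

section \<open>Circles on which an entire function of exponential type varies slowly\<close>

text \<open>The logarithmic average over \<open>r\<close> is taken without integrals: \<open>\<Phi>(r)\<close>, the sum of \<open>arsinh((r - x) R\<^sup>2)\<close>, is a smooth
substitute for the sum of the primitives of \<open>1/|r - x|\<close>. It increases by at most \<open>O(R log R)\<close> on \<open>[R, 2R]\<close>, and the mean
value theorem provides an \<open>r\<close> at which its derivative is \<open>O(log R)\<close>. A point closer to \<open>r\<close> than the smoothing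
scale \<open>1/R\<^sup>2\<close> would alone contribute at least \<open>R\<^sup>2/2\<close> to this derivative. So there is no such point, and beyond this
distance the smoothed kernel is comparable to \<open>1/|r - x|\<close>.\<close>

lemma radius_away_from_points:
  fixes A R :: real and xs :: "real list"
  assumes A: "A \<ge> 0" and R: "R \<ge> 12 * A + 36" and len: "real (length xs) \<le> A * R"
    and xs: "\<And>x. x \<in> set xs \<Longrightarrow> 0 \<le> x \<and> x \<le> 4 * R"
  obtains r where "R \<le> r" "r \<le> 2 * R" "\<And>x. x \<in> set xs \<Longrightarrow> r \<noteq> x"
    "(\<Sum>x\<leftarrow>xs. 1 / \<bar>r - x\<bar>) \<le> 4 * A * (9 + 3 * ln R)"
proof -
  have R0: "R \<ge> 36" using A R by simp
  define \<Phi> where "\<Phi> r = (\<Sum>x\<leftarrow>xs. arsinh ((r - x) * R^2))" for r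
  define V where "V r = (\<Sum>x\<leftarrow>xs. R^2 / sqrt (((r - x) * R^2)^2 + 1))" for r
  have der: "(\<Phi> has_real_derivative V r) (at r)" for r
    unfolding \<Phi>_def V_def
  proof (induction xs)
    case (Cons x xs)
    have "((\<lambda>r. arsinh ((r - x) * R^2)) has_real_derivative R^2 / sqrt (((r - x) * R^2)^2 + 1)) (at r)"
    proof -
      have "((\<lambda>r. (r - x) * R^2) has_real_derivative R^2) (at r)"
        by (auto intro!: derivative_eq_intros)
      from DERIV_chain2[OF arsinh_real_has_field_derivative this] show ?thesis by simp
    qed
    from DERIV_add[OF this Cons] show ?case by simp
  qed simp
  have "R < 2 * R" using R0 by simp
  from MVT2[OF this der] obtain r where r: "R < r" "r < 2 * R" "\<Phi> (2 * R) - \<Phi> R = (2 * R - R) * V r" by blast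
  have "\<Phi> (2 * R) - \<Phi> R \<le> real (length xs) * (2 * (9 + 3 * ln R))"
    unfolding \<Phi>_def using xs
  proof (induction xs)
    case (Cons x xs)
    have ars: "\<bar>arsinh (u * R^2)\<bar> \<le> 9 + 3 * ln R" if "\<bar>u\<bar> \<le> 4 * R" for u
    proof -
      have "\<bar>arsinh (u * R^2)\<bar> = arsinh (\<bar>u\<bar> * R^2)"
      proof -
        have "0 \<le> arsinh (\<bar>u\<bar> * R^2)"
          by (metis abs_ge_zero arsinh_real_neg_iff mult_nonneg_nonneg not_le zero_le_power2)
        moreover have "u * R^2 = \<bar>u\<bar> * R^2 \<or> u * R^2 = - (\<bar>u\<bar> * R^2)" by (auto simp: abs_if)
        ultimately show ?thesis by (metis abs_minus_cancel abs_of_nonneg arsinh_minus_real)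
      qed
      also have "\<dots> \<le> arsinh (4 * R * R^2)"
      proof -
        have "\<bar>u\<bar> * R^2 \<le> 4 * R * R^2" using that by (intro mult_right_mono) auto
        then show ?thesis by (metis arsinh_less_iff_real not_le)
      qed
      also have "\<dots> = ln (4 * R * R^2 + sqrt ((4 * R * R^2)^2 + 1))" by (simp add: arsinh_real_def)
      also have "\<dots> \<le> ln (9 * R ^ 3)"
      proof (rule ln_mono)
        have R3: "4 * R * R^2 = 4 * R^3" by (simp add: power2_eq_square power3_eq_cube)
        have "1 \<le> R^3" using R0 by simp
        then have "sqrt ((4 * R^3)^2 + 1) \<le> 4 * R^3 + 1"
          using R0 by (intro real_le_lsqrt) (auto simp: power2_eq_square algebra_simps)
        then show "4 * R * R^2 + sqrt ((4 * R * R^2)^2 + 1) \<le> 9 * R ^ 3" unfolding R3 using \<open>1 \<le> R^3\<close> by linarith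
        show "0 < 4 * R * R^2 + sqrt ((4 * R * R^2)^2 + 1)" using R0 by (intro add_pos_nonneg) auto
      qed
      also have "\<dots> = ln 9 + 3 * ln R" using R0 by (simp add: ln_mult ln_realpow)
      also have "\<dots> \<le> 9 + 3 * ln R" using ln_le_minus_one[of 9] by simp
      finally show ?thesis .
    qed
    have "\<bar>2 * R - x\<bar> \<le> 4 * R" "\<bar>R - x\<bar> \<le> 4 * R" using Cons.prems[of x] R0 by auto
    then have "arsinh ((2 * R - x) * R^2) - arsinh ((R - x) * R^2) \<le> 2 * (9 + 3 * ln R)"
      using ars[of "2 * R - x"] ars[of "R - x"] unfolding mult_2 by linarith
    then show ?case using Cons by (simp add: algebra_simps)
  qed simp
  also have "\<dots> \<le> A * R * (2 * (9 + 3 * ln R))"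
    using len R0 by (intro mult_right_mono) auto
  finally have "R * V r \<le> R * (2 * A * (9 + 3 * ln R))" using r(3) by (simp add: algebra_simps)
  then have V: "V r \<le> 2 * A * (9 + 3 * ln R)" using R0 by simp
  have "ln R \<le> R" using ln_le_minus_one[of R] R0 by linarith
  then have "2 * A * (9 + 3 * ln R) \<le> 2 * A * (9 + 3 * R)" using A by (intro mult_left_mono) auto
  also have "\<dots> < R^2 / 2"
  proof -
    have "R * (12 * A + 36) \<le> R * R" using R R0 by (intro mult_left_mono) auto
    moreover have "36 * R > 36 * A" using R A R0 by linarith
    ultimately show ?thesis using A by (simp add: power2_eq_square algebra_simps)
  qed
  finally have Vlt: "V r < R^2 / 2" using V by linarith
  have term_le: "R^2 / sqrt (((r - x) * R^2)^2 + 1) \<le> V r" if "x \<in> set xs" for x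
    unfolding V_def using that by (intro member_le_sum_list) (auto simp: image_iff)
  \<comment> \<open>a point within the smoothing scale would contribute more than the whole sum\<close>
  have far: "\<bar>r - x\<bar> * R^2 \<ge> 1" if "x \<in> set xs" for x
  proof (rule ccontr)
    assume "\<not> ?thesis"
    then have "((r - x) * R^2)^2 \<le> 1" by (simp add: abs_mult abs_square_le_1)
    then have "sqrt (((r - x) * R^2)^2 + 1) \<le> 2" by (intro real_le_lsqrt) auto
    then have "R^2 / 2 \<le> R^2 / sqrt (((r - x) * R^2)^2 + 1)"
      by (intro divide_left_mono mult_pos_pos) (auto simp: add_nonneg_pos)
    then show False using term_le[OF that] Vlt by linarith
  qed
  have ne: "r \<noteq> x" if "x \<in> set xs" for x using far[OF that] by auto
  have recip_le: "1 / \<bar>r - x\<bar> \<le> 2 * (R^2 / sqrt (((r - x) * R^2)^2 + 1))" if "x \<in> set xs" for x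
  proof -
    let ?y = "\<bar>r - x\<bar> * R^2"
    have "sqrt (((r - x) * R^2)^2 + 1) = sqrt (?y^2 + 1)" by (simp add: power_mult_distrib)
    also have "\<dots> \<le> 2 * ?y"
    proof (rule real_le_lsqrt)
      have "1 \<le> ?y^2" using far[OF that] one_le_power by blast
      moreover have "(2 * ?y)^2 = 4 * ?y^2" by (simp only: power_mult_distrib) simp
      ultimately show "?y^2 + 1 \<le> (2 * ?y)^2" by linarith
    qed auto
    finally have "R^2 / (2 * ?y) \<le> R^2 / sqrt (((r - x) * R^2)^2 + 1)"
      using far[OF that] by (intro divide_left_mono mult_pos_pos) (auto simp: add_nonneg_pos)
    moreover have "R^2 / (2 * ?y) = (1 / \<bar>r - x\<bar>) / 2" using R0 by simp
    moreover have "y \<le> 2 * X" if "y / 2 \<le> X" for X y :: real using that by simp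
    ultimately show ?thesis by metis
  qed
  have "(\<Sum>x\<leftarrow>xs. 1 / \<bar>r - x\<bar>) \<le> (\<Sum>x\<leftarrow>xs. 2 * (R^2 / sqrt (((r - x) * R^2)^2 + 1)))"
    by (rule sum_list_mono) (rule recip_le)
  also have "\<dots> = 2 * V r" unfolding V_def by (rule sum_list_const_mult)
  also have "\<dots> \<le> 4 * A * (9 + 3 * ln R)" using V by simp
  finally show ?thesis by (intro that[of r] ne less_imp_le[OF r(1)] less_imp_le[OF r(2)])
qed

text \<open>Let \<open>z\<close> be on the circle and \<open>\<zeta>\<close> at distance at most \<open>d\<close>. The zero-free cofactor changes by a bounded factor by
Harnack's inequality on the disc of radius \<open>4R\<close>. A factor \<open>1 - z/a\<close> grows at most by
\<open>1 + d/|z - a| \<le> exp(d/|r - |a||)\<close>, and by the choice of \<open>r\<close> the product of these bounds is a power of \<open>R\<close>.\<close>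

lemma good_circles_at_0:
  fixes f :: "complex \<Rightarrow> complex" and A B d :: real
  assumes f: "f holomorphic_on UNIV" and f0: "f 0 \<noteq> 0" and A: "A \<ge> 0" and B: "B \<ge> 0"
    and bd: "\<And>z. norm (f z) \<le> exp (A * norm z + B)" and d: "d \<ge> 0"
  obtains K R0 :: real and N :: nat where "K \<ge> 1" "R0 \<ge> 1"
    "\<And>R. R \<ge> R0 \<Longrightarrow> \<exists>r. R \<le> r \<and> r \<le> 2 * R \<and>
       (\<forall>z \<zeta>. norm z = r \<longrightarrow> norm (\<zeta> - z) \<le> d \<longrightarrow> norm (f \<zeta>) \<le> K * r ^ N * norm (f z))"
proof -
  define l0 where "l0 = \<bar>ln (norm (f 0))\<bar>"
  define A' where "A' = 2 * (12 * A + B + l0)"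
  have l0: "l0 \<ge> 0" and A': "A' \<ge> 0" using A B by (auto simp: A'_def l0_def)
  \<comment> \<open>\<open>A' * R\<close> bounds the number of zeros of \<open>f\<close> in the disc of radius \<open>4 * R\<close>\<close>
  define R0 where "R0 = max (12 * A' + 36) d"
  define N where "N = nat \<lceil>12 * A' * d\<rceil>"
  define K where "K = exp (4 * d * A' + 36 * A' * d)"
  have circle: "\<exists>r. R \<le> r \<and> r \<le> 2 * R \<and>
       (\<forall>z \<zeta>. norm z = r \<longrightarrow> norm (\<zeta> - z) \<le> d \<longrightarrow> norm (f \<zeta>) \<le> K * r ^ N * norm (f z))" if R: "R \<ge> R0" for R
  proof -
    have R36: "R \<ge> 36" and Rd: "R \<ge> d" and RA: "R \<ge> 12 * A' + 36" using R A' by (auto simp: R0_def)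
    define S where "S = A * (12 * R) + B"
    have "4 * R > 0" using R36 by simp
    from zero_factorization[OF f f0 this] obtain as G where G: "G holomorphic_on UNIV"
      "\<And>z. f z = G z * (\<Prod>a\<leftarrow>as. 1 - z / a)"
      "\<And>a. a \<in> set as \<Longrightarrow> a \<noteq> 0 \<and> norm a \<le> 4 * R" "\<And>z. norm z \<le> 4 * R \<Longrightarrow> G z \<noteq> 0"
      by metis
    have G0: "G 0 = f 0"
    proof -
      have "(\<Prod>a\<leftarrow>as. 1 - 0 / a) = (1 :: complex)" by (induction as) auto
      then show ?thesis using G(2)[of 0] by simp
    qed
    have cof: "norm (G z) * 2 ^ length as \<le> exp S" if "norm z \<le> 12 * R" for z
    proof (rule cofactor_bound[OF G(1), where R = "4 * R"])
      fix u :: complex assume "norm u = 3 * (4 * R)"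
      then show "norm (G u * (\<Prod>a\<leftarrow>as. 1 - u / a)) \<le> exp S"
        using bd[of u] by (simp add: S_def flip: G(2))
    qed (use G(3) that in auto)
    have "S - ln (norm (f 0)) \<le> (12 * A + B + l0) * R"
    proof -
      have "B \<le> B * R" "l0 \<le> l0 * R" using B l0 R36 mult_left_mono[of 1 R B] mult_left_mono[of 1 R l0] by auto
      moreover have "- ln (norm (f 0)) \<le> l0" by (simp add: l0_def)
      ultimately show ?thesis unfolding S_def distrib_right by linarith
    qed
    then have S: "S - ln (norm (f 0)) \<le> A' / 2 * R"
      unfolding A'_def by (simp only: nonzero_mult_div_cancel_left[of 2] zero_neq_numeral not_False_eq_True)
    have len: "real (length as) \<le> A' * R"
    proof -
      have "norm (f 0) * 2 ^ length as \<le> exp S" using cof[of 0] R36 G0 by simp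
      then have "ln (norm (f 0) * 2 ^ length as) \<le> ln (exp S)" using f0 by (intro ln_mono) auto
      then have "ln (norm (f 0)) + real (length as) * ln 2 \<le> S" using f0 by (simp add: ln_mult ln_realpow)
      moreover have "real (length as) * (1/2) \<le> real (length as) * ln 2"
        using ln2_ge_two_thirds by (intro mult_left_mono) auto
      ultimately show ?thesis using S by linarith
    qed
    obtain r where r: "R \<le> r" "r \<le> 2 * R" "\<And>a. a \<in> set as \<Longrightarrow> r \<noteq> norm a"
      "(\<Sum>a\<leftarrow>as. 1 / \<bar>r - norm a\<bar>) \<le> 4 * A' * (9 + 3 * ln R)"
    proof (rule radius_away_from_points[OF A' RA, of "map norm as"])
      fix r assume "R \<le> r" "r \<le> 2 * R" "\<And>x. x \<in> set (map norm as) \<Longrightarrow> r \<noteq> x"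
        "(\<Sum>x\<leftarrow>map norm as. 1 / \<bar>r - x\<bar>) \<le> 4 * A' * (9 + 3 * ln R)"
      then show thesis by (intro that[of r]) (auto simp: o_def)
    qed (use len G(3) in auto)
    have "norm (f \<zeta>) \<le> K * r ^ N * norm (f z)" if z: "norm z = r" and \<zeta>: "norm (\<zeta> - z) \<le> d" for z \<zeta>
    proof -
      have nz: "norm z \<le> 3 * R" using z r R36 by linarith
      have n\<zeta>: "norm \<zeta> \<le> 3 * R" using norm_triangle_sub[of \<zeta> z] z r \<zeta> Rd by linarith
      have hn: "ln (norm (G \<zeta>)) - ln (norm (G z)) \<le> 2 * (4 * R) * norm (\<zeta> - z) / (4 * R - 3 * R)^2 * (S - ln (norm (G 0)))"
      proof (rule harnack_zero_free[OF G(1) G(4)])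
        fix u :: complex assume u: "norm u = 4 * R"
        have "norm (G u) * 1 \<le> norm (G u) * 2 ^ length as" by (intro mult_left_mono) auto
        then show "norm (G u) \<le> exp S" using cof[of u] u R36 by simp
      qed (use nz n\<zeta> R36 in auto)
      also have "\<dots> = 8 * norm (\<zeta> - z) / R * (S - ln (norm (f 0)))"
        using R36 G0 by (simp add: power2_eq_square)
      also have "\<dots> \<le> 8 * norm (\<zeta> - z) / R * (A' / 2 * R)"
        using S R36 by (intro mult_left_mono) auto
      also have "\<dots> = 4 * A' * norm (\<zeta> - z)" using R36 by simp
      also have "\<dots> \<le> 4 * A' * d" using \<zeta> A' by (intro mult_left_mono) auto
      finally have "ln (norm (G \<zeta>)) \<le> ln (norm (G z)) + 4 * A' * d" by simp
      then have "exp (ln (norm (G \<zeta>))) \<le> exp (ln (norm (G z)) + 4 * A' * d)" by simp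
      then have G\<zeta>: "norm (G \<zeta>) \<le> norm (G z) * exp (4 * A' * d)"
        using G(4)[of z] G(4)[of \<zeta>] nz n\<zeta> R36 by (simp add: exp_add)
      have factor: "norm (1 - \<zeta> / a) \<le> exp (d * (1 / \<bar>r - norm a\<bar>)) * norm (1 - z / a)" if a: "a \<in> set as" for a
      proof -
        have pos: "\<bar>r - norm a\<bar> > 0" using r(3)[OF a] by simp
        have far: "\<bar>r - norm a\<bar> \<le> norm (z - a)" using z norm_triangle_ineq3[of z a] by simp
        have "d * 1 \<le> d * (norm (z - a) / \<bar>r - norm a\<bar>)"
          using far pos d by (intro mult_left_mono) (auto simp: le_divide_eq)
        then have "d \<le> d * (1 / \<bar>r - norm a\<bar>) * norm (z - a)" by simp
        moreover have "norm (\<zeta> - a) \<le> norm (z - a) + d"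
          using norm_triangle_ineq[of "z - a" "\<zeta> - z"] \<zeta> by simp
        ultimately have "norm (\<zeta> - a) \<le> (1 + d * (1 / \<bar>r - norm a\<bar>)) * norm (z - a)"
          unfolding distrib_right by linarith
        also have "\<dots> \<le> exp (d * (1 / \<bar>r - norm a\<bar>)) * norm (z - a)"
          by (intro mult_right_mono exp_ge_add_one_self) auto
        finally have "norm (\<zeta> - a) / norm a \<le> exp (d * (1 / \<bar>r - norm a\<bar>)) * norm (z - a) / norm a"
          by (intro divide_right_mono) auto
        moreover have "1 - u / a = (a - u) / a" for u using G(3)[OF a] by (simp add: diff_divide_distrib)
        ultimately show ?thesis by (simp add: norm_divide norm_minus_commute)
      qed
      have "(\<Prod>a\<leftarrow>as. norm (1 - \<zeta> / a)) \<le> (\<Prod>a\<leftarrow>as. exp (d * (1 / \<bar>r - norm a\<bar>)) * norm (1 - z / a))"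
        using factor by (intro prod_list_mono_nonneg[THEN conjunct2]) auto
      also have "\<dots> = exp (d * (\<Sum>a\<leftarrow>as. 1 / \<bar>r - norm a\<bar>)) * (\<Prod>a\<leftarrow>as. norm (1 - z / a))"
        by (induction as) (auto simp: distrib_left exp_add)
      also have "\<dots> \<le> exp (d * (4 * A' * (9 + 3 * ln R))) * (\<Prod>a\<leftarrow>as. norm (1 - z / a))"
        using r(4) d prod_list_mono_nonneg[of as "\<lambda>a. norm (1 - z / a)" "\<lambda>a. norm (1 - z / a)"]
        by (intro mult_right_mono) (auto intro: mult_left_mono)
      finally have prods: "(\<Prod>a\<leftarrow>as. norm (1 - \<zeta> / a)) \<le> exp (d * (4 * A' * (9 + 3 * ln R))) * (\<Prod>a\<leftarrow>as. norm (1 - z / a))" .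
      have "0 \<le> (\<Prod>a\<leftarrow>as. norm (1 - \<zeta> / a))"
        using prod_list_mono_nonneg[of as "\<lambda>a. norm (1 - \<zeta> / a)" "\<lambda>a. norm (1 - \<zeta> / a)"] by auto
      then have "norm (f \<zeta>) \<le> (norm (G z) * exp (4 * A' * d)) * (exp (d * (4 * A' * (9 + 3 * ln R))) * (\<Prod>a\<leftarrow>as. norm (1 - z / a)))"
        unfolding G(2)[of \<zeta>] norm_mult norm_prod_list by (intro mult_mono G\<zeta> prods) auto
      also have "\<dots> = (exp (4 * A' * d) * exp (d * (4 * A' * (9 + 3 * ln R)))) * norm (f z)"
        unfolding G(2)[of z] norm_mult norm_prod_list by simp
      also have "exp (4 * A' * d) * exp (d * (4 * A' * (9 + 3 * ln R))) = K * exp (12 * A' * d * ln R)"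
        unfolding K_def exp_add[symmetric] by (simp add: algebra_simps)
      also have "K * exp (12 * A' * d * ln R) * norm (f z) \<le> K * r ^ N * norm (f z)"
      proof (intro mult_right_mono mult_left_mono)
        have "exp (12 * A' * d * ln R) \<le> exp (real N * ln R)"
          unfolding exp_le_cancel_iff using R36 real_nat_ceiling_ge by (intro mult_right_mono) (auto simp: N_def)
        also have "\<dots> = R ^ N" using R36 by (simp add: exp_of_nat_mult)
        also have "\<dots> \<le> r ^ N" using r R36 by (intro power_mono) auto
        finally show "exp (12 * A' * d * ln R) \<le> r ^ N" .
      qed (auto simp: K_def)
      finally show ?thesis .
    qed
    then show ?thesis using r by blast
  qed
  have "K \<ge> 1" using A' d by (simp add: K_def)
  moreover have "R0 \<ge> 1" using A' by (simp add: R0_def)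
  ultimately show ?thesis using that circle by blast
qed

lemma good_circles:
  fixes f :: "complex \<Rightarrow> complex" and A B d :: real
  assumes f: "f holomorphic_on UNIV" and f0: "f z0 \<noteq> 0" and A: "A \<ge> 0" and B: "B \<ge> 0"
    and bd: "\<And>z. norm (f z) \<le> exp (A * norm z + B)" and d: "d \<ge> 0"
  obtains K R0 :: real and N :: nat where "K \<ge> 1" "R0 \<ge> 1"
    "\<And>R. R \<ge> R0 \<Longrightarrow> \<exists>r. R \<le> r \<and> r \<le> 2 * R \<and>
       (\<forall>z \<zeta>. norm (z - z0) = r \<longrightarrow> norm (\<zeta> - z) \<le> d \<longrightarrow> norm (f \<zeta>) \<le> K * r ^ N * norm (f z))"
proof -
  have g: "(\<lambda>z. f (z + z0)) holomorphic_on UNIV"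
    by (intro holomorphic_on_compose_gen[unfolded o_def, OF _ f] holomorphic_intros) auto
  have bd': "norm (f (z + z0)) \<le> exp (A * norm z + (A * norm z0 + B))" for z
  proof -
    have "A * norm (z + z0) \<le> A * (norm z + norm z0)" using A norm_triangle_ineq by (intro mult_left_mono) auto
    then have "exp (A * norm (z + z0) + B) \<le> exp (A * norm z + (A * norm z0 + B))" by (simp add: distrib_left)
    then show ?thesis using bd[of "z + z0"] by linarith
  qed
  obtain K R0 :: real and N :: nat where K: "K \<ge> 1" "R0 \<ge> 1"
    "\<And>R. R \<ge> R0 \<Longrightarrow> \<exists>r. R \<le> r \<and> r \<le> 2 * R \<and>
       (\<forall>z \<zeta>. norm z = r \<longrightarrow> norm (\<zeta> - z) \<le> d \<longrightarrow> norm (f (\<zeta> + z0)) \<le> K * r ^ N * norm (f (z + z0)))"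
    using good_circles_at_0[OF g _ A _ bd' d] f0 A B by (metis add_0 add_nonneg_nonneg mult_nonneg_nonneg norm_ge_zero)
  show ?thesis
  proof (rule that[OF K(1,2)])
    fix R assume "R \<ge> R0"
    then obtain r where r: "R \<le> r" "r \<le> 2 * R" "\<And>z \<zeta>. norm z = r \<Longrightarrow> norm (\<zeta> - z) \<le> d \<Longrightarrow> norm (f (\<zeta> + z0)) \<le> K * r ^ N * norm (f (z + z0))"
      using K(3) by metis
    have "norm (f \<zeta>) \<le> K * r ^ N * norm (f z)" if "norm (z - z0) = r" "norm (\<zeta> - z) \<le> d" for z \<zeta>
      using r(3)[of "z - z0" "\<zeta> - z0"] that by simp
    then show "\<exists>r. R \<le> r \<and> r \<le> 2 * R \<and>
       (\<forall>z \<zeta>. norm (z - z0) = r \<longrightarrow> norm (\<zeta> - z) \<le> d \<longrightarrow> norm (f \<zeta>) \<le> K * r ^ N * norm (f z))"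
      using r(1,2) by blast
  qed
qed

section \<open>Vanishing of the differential polynomial\<close>

lemma polynomial_if_bounded_on_circles:
  fixes g :: "complex \<Rightarrow> complex"
  assumes g: "g holomorphic_on UNIV" and K: "K \<ge> 0"
    and bd: "\<And>R. R \<ge> R0 \<Longrightarrow> \<exists>r. R \<le> r \<and> r \<le> 2 * R \<and> (\<forall>z. norm (z - z0) = r \<longrightarrow> norm (g z) \<le> K * r ^ N)"
  shows "\<exists>q. \<forall>z. g z = poly q z"
proof -
  define h where "h z = g (z + z0)" for z
  have h: "h holomorphic_on UNIV" unfolding h_def
    by (intro holomorphic_on_compose_gen[unfolded o_def, OF _ g] holomorphic_intros) auto
  have hb: "norm (h z) \<le> K * 2 ^ N * norm z ^ N" if z: "norm z \<ge> R0" for z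
  proof -
    obtain r where r: "norm z \<le> r" "r \<le> 2 * norm z" "\<And>u. norm (u - z0) = r \<Longrightarrow> norm (g u) \<le> K * r ^ N"
      using bd[OF z] by blast
    have "norm (h z) \<le> K * r ^ N"
    proof (rule max_modulus_cball[OF h _ r(1)])
      show "norm (h u) \<le> K * r ^ N" if "norm u = r" for u
        using r(3)[of "u + z0"] that by (simp add: h_def)
    qed
    also have "\<dots> \<le> K * (2 * norm z) ^ N"
      using r K norm_ge_zero[of z] by (intro mult_left_mono power_mono) (auto intro: order_trans)
    finally show ?thesis by (simp add: power_mult_distrib mult_ac)
  qed
  define q where "q = (\<Sum>k\<le>N. monom ((deriv ^^ k) h 0 / fact k) k)"
  have "h z = poly q z" for z
    unfolding q_def poly_sum poly_monom by (rule Liouville_polynomial[OF h hb])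
  then have "g z = poly (pcompose q [:- z0, 1:]) z" for z
    using h_def[of "z - z0"] by (simp add: poly_pcompose)
  then show ?thesis by blast
qed

lemma poly_bounded_away_from_0:
  fixes q :: "complex poly"
  assumes "q \<noteq> 0"
  obtains \<delta> r where "\<delta> > 0" "\<And>z. norm z \<ge> r \<Longrightarrow> norm (poly q z) \<ge> \<delta>"
proof (cases q)
  case (pCons a p)
  show ?thesis
  proof (cases "p = 0")
    case True
    then show ?thesis using that[of "norm a" 0] assms pCons by auto
  next
    case False
    then show ?thesis using poly_infinity[OF False, of 1 a] that[of 1] pCons by auto
  qed
qed

text \<open>Where \<open>|f| \<le> 1\<close> the first bound controls \<open>\<psi>\<close> and \<open>f \<psi>\<close>, and where \<open>|f| > 1\<close> the second one does since \<open>m \<ge> 2\<close>. So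
\<open>\<psi>\<close> is a polynomial. If it is not zero it stays away from 0 on large circles, and the bound on \<open>f \<psi>\<close> makes
\<open>f\<close> a polynomial.\<close>

lemma clunie_vanishing:
  fixes f \<psi> :: "complex \<Rightarrow> complex"
  assumes f: "f holomorphic_on UNIV" and nonpoly: "\<not> (\<exists>q. \<forall>z. f z = poly q z)"
    and \<psi>: "\<psi> holomorphic_on UNIV" and K: "K \<ge> 0" and R0: "R0 \<ge> 1" and m: "m \<ge> 2"
    and bd: "\<And>R. R \<ge> R0 \<Longrightarrow> \<exists>r. R \<le> r \<and> r \<le> 2 * R \<and> (\<forall>z. norm (z - z0) = r \<longrightarrow>
        norm (\<psi> z) \<le> K * r ^ N * norm (f z) ^ 3 \<and> norm (f z) ^ m * norm (\<psi> z) \<le> K * r ^ N * norm (f z))"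
  shows "\<psi> z = 0"
proof -
  have both: "norm (\<psi> z) \<le> K * r ^ N \<and> norm (f z) * norm (\<psi> z) \<le> K * r ^ N"
    if 1: "norm (\<psi> z) \<le> K * r ^ N * norm (f z) ^ 3" and 2: "norm (f z) ^ m * norm (\<psi> z) \<le> K * r ^ N * norm (f z)"
      and r: "r \<ge> 0" for z r
  proof (cases "norm (f z) \<le> 1")
    case True
    have "K * r ^ N * norm (f z) ^ 3 \<le> K * r ^ N * 1"
      using True K r by (intro mult_left_mono power_le_one) auto
    then have "norm (\<psi> z) \<le> K * r ^ N" using 1 by simp
    moreover have "norm (f z) * norm (\<psi> z) \<le> 1 * norm (\<psi> z)" using True by (intro mult_right_mono) auto
    ultimately show ?thesis by simp
  next
    case False
    have "norm (f z) * (norm (f z) * norm (\<psi> z)) \<le> norm (f z) ^ m * norm (\<psi> z)"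
      unfolding mult.assoc[symmetric] power2_eq_square[symmetric]
      using False m by (intro mult_right_mono power_increasing) auto
    also have "\<dots> \<le> norm (f z) * (K * r ^ N)" using 2 by (simp add: mult_ac)
    finally have "norm (f z) * norm (\<psi> z) \<le> K * r ^ N"
      by (rule mult_left_le_imp_le) (use False in linarith)
    moreover have "1 * norm (\<psi> z) \<le> norm (f z) * norm (\<psi> z)" using False by (intro mult_right_mono) auto
    ultimately show ?thesis by simp
  qed
  have circ: "\<exists>r. R \<le> r \<and> r \<le> 2 * R \<and> (\<forall>z. norm (z - z0) = r \<longrightarrow> norm (\<psi> z) \<le> K * r ^ N \<and> norm (f z) * norm (\<psi> z) \<le> K * r ^ N)"
    if R: "R \<ge> R0" for R
  proof -
    obtain r where r: "R \<le> r" "r \<le> 2 * R" "\<And>z. norm (z - z0) = r \<Longrightarrow>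
        norm (\<psi> z) \<le> K * r ^ N * norm (f z) ^ 3 \<and> norm (f z) ^ m * norm (\<psi> z) \<le> K * r ^ N * norm (f z)"
      using bd[OF R] by blast
    have "r \<ge> 0" using r(1) R R0 by linarith
    then show ?thesis using both r by (intro exI[of _ r]) blast
  qed
  have "\<exists>q. \<forall>z. \<psi> z = poly q z"
    by (rule polynomial_if_bounded_on_circles[OF \<psi> K]) (use circ in blast)
  then obtain q where q: "\<And>z. \<psi> z = poly q z" by blast
  have "q = 0"
  proof (rule ccontr)
    assume "q \<noteq> 0"
    then obtain \<delta> s where \<delta>: "\<delta> > 0" "\<And>z. norm z \<ge> s \<Longrightarrow> norm (poly q z) \<ge> \<delta>"
      using poly_bounded_away_from_0 by metis
    have "\<exists>p. \<forall>z. f z = poly p z"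
    proof (rule polynomial_if_bounded_on_circles[OF f])
      show "K / \<delta> \<ge> 0" using K \<delta> by simp
      fix R assume R: "R \<ge> max R0 (s + norm z0)"
      then obtain r where r: "R \<le> r" "r \<le> 2 * R" "\<And>z. norm (z - z0) = r \<Longrightarrow> norm (f z) * norm (\<psi> z) \<le> K * r ^ N"
        using circ[of R] by auto
      have "norm (f z) \<le> K / \<delta> * r ^ N" if "norm (z - z0) = r" for z
      proof -
        have "norm z \<ge> s" using R r(1) that norm_triangle_ineq4[of z z0] by auto
        then have "norm (f z) * \<delta> \<le> norm (f z) * norm (\<psi> z)" using \<delta> q by (intro mult_left_mono) auto
        then have "norm (f z) * \<delta> \<le> K * r ^ N" using r(3)[OF that] by linarith
        then show ?thesis using \<delta> by (simp add: field_simps)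
      qed
      then show "\<exists>r. R \<le> r \<and> r \<le> 2 * R \<and> (\<forall>z. norm (z - z0) = r \<longrightarrow> norm (f z) \<le> K / \<delta> * r ^ N)"
        using r by blast
    qed
    then show False using nonpoly by blast
  qed
  then show ?thesis using q by simp
qed

lemma higher_deriv_has_field_derivative:
  fixes f :: "complex \<Rightarrow> complex"
  assumes "f holomorphic_on UNIV"
  shows "((deriv ^^ j) f has_field_derivative (deriv ^^ Suc j) f z) (at z)"
  using holomorphic_derivI[OF holomorphic_higher_deriv[OF assms open_UNIV, of j] open_UNIV, of z] by simp

text \<open>Here \<open>E0 = f\<^bsup>n-1\<^esup>(f + w f')\<close>, with derivatives \<open>E1\<close> and \<open>E2\<close>, and \<open>Q\<close> is the operator \<open>D\<close> applied to the shifted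
term, so that \<open>f\<^sup>m \<psi> = - Q\<close> with \<open>m = n - 3\<close>. On a good circle every derivative of \<open>f\<close> near \<open>z\<close>, including those
at \<open>z + c\<close>, is bounded by a constant times \<open>r\<^sup>N |f(z)|\<close>. As \<open>\<psi>\<close> is homogeneous of degree 3 and \<open>Q\<close> of degree 1,
these are the hypotheses of \<open>clunie_vanishing\<close>.\<close>

lemma linear_part_annihilated:
  fixes f :: "complex \<Rightarrow> complex" and n k :: nat and c w p1 p2 \<alpha>1 \<alpha>2 :: complex
  assumes n: "n \<ge> 5" and f: "f holomorphic_on UNIV" and nonpoly: "\<not> (\<exists>q. \<forall>z. f z = poly q z)"
    and A: "A \<ge> 0" and B: "B \<ge> 0" and bd: "\<And>z. norm (f z) \<le> exp (A * norm z + B)"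
    and eq: "\<And>z. f z ^ n + w * f z ^ (n - 1) * deriv f z + (deriv ^^ k) f (z + c)
               = p1 * exp (\<alpha>1 * z) + p2 * exp (\<alpha>2 * z)"
  shows "(deriv ^^ (k + 2)) f z - (\<alpha>1 + \<alpha>2) * (deriv ^^ (k + 1)) f z + \<alpha>1 * \<alpha>2 * (deriv ^^ k) f z = 0"
proof -
  define m where "m = n - 3"
  have m: "m \<ge> 2" "n = m + 3" using n by (auto simp: m_def)
  define s q where "s = \<alpha>1 + \<alpha>2" and "q = \<alpha>1 * \<alpha>2"
  define F where "F j = (deriv ^^ j) f" for j
  have dF: "(F j has_field_derivative F (Suc j) z) (at z)" for j z
    unfolding F_def by (rule higher_deriv_has_field_derivative[OF f])
  have F0: "f = F 0" and F1: "deriv f = F 1" by (auto simp: F_def)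
  have holF: "F j holomorphic_on UNIV" for j
    unfolding F_def by (intro holomorphic_higher_deriv f) auto
  define L where "L j z = F (k + j) (z + c)" for j z
  have dL: "(L j has_field_derivative L (Suc j) z) (at z)" for j z
    using dF[of "k + j" "z + c"] unfolding L_def by (simp add: DERIV_shift)
  define u where "u j z = F j z + w * F (Suc j) z" for j z
  have du: "(u j has_field_derivative u (Suc j) z) (at z)" for j z
    unfolding u_def by (intro derivative_intros DERIV_cmult dF)
  define P where "P j z = \<alpha>1 ^ j * p1 * exp (\<alpha>1 * z) + \<alpha>2 ^ j * p2 * exp (\<alpha>2 * z)" for j z
  have dP: "(P j has_field_derivative P (Suc j) z) (at z)" for j z
    unfolding P_def by (auto intro!: derivative_eq_intros simp: algebra_simps)
  define \<mu> :: complex where "\<mu> = of_nat (m + 2)"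
  define \<nu> :: complex where "\<nu> = of_nat (m + 1)"
  have dpow: "((\<lambda>z. F 0 z ^ (m + 2)) has_field_derivative \<mu> * F 0 z ^ (m + 1) * F 1 z) (at z)"
    "((\<lambda>z. F 0 z ^ (m + 1)) has_field_derivative \<nu> * F 0 z ^ m * F 1 z) (at z)" for z
    using DERIV_power[OF dF[of 0 z], of "m + 2"] DERIV_power[OF dF[of 0 z], of "m + 1"]
    by (simp_all add: \<mu>_def \<nu>_def mult_ac)
  define E0 E1 E2 where "E0 z = F 0 z ^ (m + 2) * u 0 z"
    and "E1 z = \<mu> * F 0 z ^ (m + 1) * F 1 z * u 0 z + F 0 z ^ (m + 2) * u 1 z"
    and "E2 z = \<mu> * (\<nu> * F 0 z ^ m * F 1 z) * F 1 z * u 0 z + \<mu> * F 0 z ^ (m + 1) * F 2 z * u 0 z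
        + 2 * \<mu> * F 0 z ^ (m + 1) * F 1 z * u 1 z + F 0 z ^ (m + 2) * u 2 z" for z
  have dE0: "(E0 has_field_derivative E1 z) (at z)" for z
    unfolding E0_def E1_def
    by (rule DERIV_cong[OF DERIV_mult[OF dpow(1) du]]) (simp add: algebra_simps)
  have dE1: "(E1 has_field_derivative E2 z) (at z)" for z
    unfolding E1_def E2_def
    by (rule DERIV_cong[OF DERIV_add[OF DERIV_mult[OF DERIV_mult[OF DERIV_cmult[OF dpow(2)] dF] du] DERIV_mult[OF dpow(1) du]]])
       (simp add: algebra_simps numeral_2_eq_2)
  have e0: "E0 = (\<lambda>z. P 0 z - L 0 z)"
  proof
    fix z
    have "E0 z = f z ^ n + w * f z ^ (n - 1) * deriv f z"
      unfolding F1 unfolding E0_def u_def F0 m(2) by (simp add: power_add algebra_simps power2_eq_square power3_eq_cube)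
    then show "E0 z = P 0 z - L 0 z" using eq[of z] by (simp add: P_def L_def F_def algebra_simps)
  qed
  have e1: "E1 = (\<lambda>z. P 1 z - L 1 z)"
  proof
    fix z
    have "((\<lambda>z. P 0 z - L 0 z) has_field_derivative P 1 z - L 1 z) (at z)"
      using DERIV_diff[OF dP[of 0 z] dL[of 0 z]] by simp
    then show "E1 z = P 1 z - L 1 z" using dE0[of z] unfolding e0 by (rule DERIV_unique[OF _ _, symmetric])
  qed
  have e2: "E2 z = P 2 z - L 2 z" for z
  proof -
    have "((\<lambda>z. P 1 z - L 1 z) has_field_derivative P 2 z - L 2 z) (at z)"
      using DERIV_diff[OF dP[of 1 z] dL[of 1 z]] by (simp add: numeral_2_eq_2)
    then show ?thesis using dE1[of z] unfolding e1 by (rule DERIV_unique[OF _ _, symmetric])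
  qed
  define \<psi> where "\<psi> z = \<mu> * \<nu> * (F 1 z * F 1 z * u 0 z) + \<mu> * (F 0 z * F 2 z * u 0 z)
      + 2 * \<mu> * (F 0 z * F 1 z * u 1 z) + F 0 z * F 0 z * u 2 z
      - s * \<mu> * (F 0 z * F 1 z * u 0 z) - s * (F 0 z * F 0 z * u 1 z) + q * (F 0 z * F 0 z * u 0 z)" for z
  define Q where "Q z = L 2 z - s * L 1 z + q * L 0 z" for z
  have psiE: "F 0 z ^ m * \<psi> z = E2 z - s * E1 z + q * E0 z" for z
    unfolding \<psi>_def E0_def E1_def E2_def by (simp add: power_add power2_eq_square algebra_simps)
  have "P 2 z - s * P 1 z + q * P 0 z = 0" for z
    unfolding P_def s_def q_def by (simp add: power2_eq_square algebra_simps)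
  then have psiQ: "F 0 z ^ m * \<psi> z = - Q z" for z
    unfolding psiE e2 unfolding e0 e1 Q_def by (simp add: algebra_simps)
  have hol_psi: "\<psi> holomorphic_on UNIV"
    unfolding \<psi>_def u_def by (intro holomorphic_intros holF)
  have "\<exists>z0. f z0 \<noteq> 0" using nonpoly by (metis poly_0)
  then obtain z0 where z0: "f z0 \<noteq> 0" by blast
  define d where "d = norm c + 1"
  have "d \<ge> 0" by (simp add: d_def)
  obtain K R0 :: real and N :: nat where K: "K \<ge> 1" "R0 \<ge> 1"
    "\<And>R. R \<ge> R0 \<Longrightarrow> \<exists>r. R \<le> r \<and> r \<le> 2 * R \<and>
       (\<forall>z \<zeta>. norm (z - z0) = r \<longrightarrow> norm (\<zeta> - z) \<le> d \<longrightarrow> norm (f \<zeta>) \<le> K * r ^ N * norm (f z))"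
    using good_circles[OF f z0 A B bd \<open>d \<ge> 0\<close>] by metis
  define C1 where "C1 = norm (\<mu> * \<nu>) + norm \<mu> + norm (2 * \<mu>) + 1 + norm (s * \<mu>) + norm s + norm q"
  define C2 :: real where "C2 = fact (k + 2) + norm s * fact (k + 1) + norm q * fact k"
  \<comment> \<open>all of \<open>F j\<close> and \<open>u j\<close> in \<open>\<psi>\<close> are at most \<open>W * r ^ N * norm (f z)\<close>; 6 is the factorial of 3\<close>
  define W where "W = 6 * (1 + norm w) * K"
  define K' where "K' = C1 * W ^ 3 + C2 * K"
  have C: "C1 \<ge> 0" "C2 \<ge> 0" "W \<ge> 0" using K(1) by (auto simp: C1_def C2_def W_def)
  have K'0: "K' \<ge> 0" using C K(1) by (simp add: K'_def)
  have psi0: "\<psi> z = 0" for z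
  proof (rule clunie_vanishing[OF f nonpoly hol_psi K'0 K(2) m(1)])
    fix R assume R: "R \<ge> R0"
    then obtain r where r: "R \<le> r" "r \<le> 2 * R" and
      near: "\<And>z \<zeta>. norm (z - z0) = r \<Longrightarrow> norm (\<zeta> - z) \<le> d \<Longrightarrow> norm (f \<zeta>) \<le> K * r ^ N * norm (f z)"
      using K(3) by metis
    have r1: "r \<ge> 1" using r(1) R K(2) by linarith
    have "norm (\<psi> z) \<le> K' * r ^ (3 * N) * norm (f z) ^ 3 \<and> norm (f z) ^ m * norm (\<psi> z) \<le> K' * r ^ (3 * N) * norm (f z)"
      if z: "norm (z - z0) = r" for z
    proof -
      define M where "M = K * r ^ N * norm (f z)"
      have M0: "M \<ge> 0" using K(1) r1 by (simp add: M_def)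
      have Fb: "norm (F j z) \<le> fact j * M" for j
        unfolding F_def
      proof (rule norm_higher_deriv_le[OF f])
        fix v assume "norm (v - z) \<le> 1"
        then have "norm (v - z) \<le> d" by (simp add: d_def add_increasing)
        then show "norm (f v) \<le> M" using near[OF z] by (simp add: M_def)
      qed
      have Lb: "norm (L j z) \<le> fact (k + j) * M" for j
        unfolding L_def F_def
      proof (rule norm_higher_deriv_le[OF f])
        fix v assume "norm (v - (z + c)) \<le> 1"
        then have "norm (v - z) \<le> d"
          using norm_triangle_ineq[of "v - (z + c)" c] by (simp add: d_def)
        then show "norm (f v) \<le> M" using near[OF z] by (simp add: M_def)
      qed
      define b where "b = 6 * (1 + norm w) * M"
      have b0: "b \<ge> 0" using M0 by (simp add: b_def)
      have F6: "norm (F j z) \<le> 6 * M" if "j \<le> 3" for j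
      proof -
        have "fact j \<le> (fact 3 :: real)" using that by (rule fact_mono)
        then have "fact j * M \<le> 6 * M" using M0 by (intro mult_right_mono) (auto simp: fact_numeral)
        then show ?thesis using Fb[of j] by linarith
      qed
      have bF: "norm (F j z) \<le> b" if "j \<le> 3" for j
      proof -
        have "6 * M \<le> b" using M0 by (simp add: b_def algebra_simps)
        then show ?thesis using F6[OF that] by linarith
      qed
      have bu: "norm (u j z) \<le> b" if "j \<le> 2" for j
      proof -
        have "norm (u j z) \<le> norm (F j z) + norm w * norm (F (Suc j) z)"
          unfolding u_def using norm_triangle_ineq[of "F j z" "w * F (Suc j) z"] by (simp add: norm_mult)
        also have "\<dots> \<le> 6 * M + norm w * (6 * M)"
          using F6[of j] F6[of "Suc j"] that by (intro add_mono mult_left_mono) auto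
        also have "\<dots> = b" by (simp add: b_def algebra_simps)
        finally show ?thesis .
      qed
      have prod3: "norm (a * (x * y * v)) \<le> norm a * b ^ 3" if "norm x \<le> b" "norm y \<le> b" "norm v \<le> b" for a x y v :: complex
        unfolding norm_mult power3_eq_cube using that b0
        by (intro mult_left_mono mult_mono mult_nonneg_nonneg) auto
      have "norm (\<psi> z) \<le> norm (\<mu> * \<nu>) * b^3 + norm \<mu> * b^3 + norm (2 * \<mu>) * b^3 + norm (1::complex) * b^3
          + norm (s * \<mu>) * b^3 + norm s * b^3 + norm q * b^3"
        unfolding \<psi>_def
        by (intro norm_triangle_le norm_triangle_le_diff add_mono prod3 bF bu
              order_trans[OF _ prod3[of "F 0 z" "F 0 z" "u 2 z" 1]]) auto
      also have "\<dots> = C1 * b ^ 3" by (simp add: C1_def algebra_simps)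
      also have "b = W * r ^ N * norm (f z)" by (simp add: b_def W_def M_def)
      also have "C1 * (W * r ^ N * norm (f z)) ^ 3 = C1 * W ^ 3 * r ^ (3 * N) * norm (f z) ^ 3"
        by (simp add: power_mult_distrib mult.commute[of 3] flip: power_mult)
      also have "\<dots> \<le> K' * r ^ (3 * N) * norm (f z) ^ 3"
        using C K(1) r1 by (intro mult_right_mono) (auto simp: K'_def)
      finally have 1: "norm (\<psi> z) \<le> K' * r ^ (3 * N) * norm (f z) ^ 3" .
      have "norm (f z) ^ m * norm (\<psi> z) = norm (Q z)"
        using arg_cong[OF psiQ[of z], of norm] by (simp add: norm_mult norm_power F0)
      also have "\<dots> \<le> fact (k + 2) * M + norm s * (fact (k + 1) * M) + norm q * (fact k * M)"
        unfolding Q_def using Lb[of 2] Lb[of 1] Lb[of 0]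
        by (intro norm_triangle_le norm_triangle_le_diff add_mono) (auto simp: norm_mult intro: mult_left_mono)
      also have "\<dots> = C2 * K * r ^ N * norm (f z)" by (simp add: C2_def M_def algebra_simps)
      also have "\<dots> \<le> K' * r ^ (3 * N) * norm (f z)"
        using C K(1) r1 by (intro mult_right_mono mult_mono power_increasing) (auto simp: K'_def)
      finally show ?thesis using 1 by blast
    qed
    then show "\<exists>r. R \<le> r \<and> r \<le> 2 * R \<and> (\<forall>z. norm (z - z0) = r \<longrightarrow>
        norm (\<psi> z) \<le> K' * r ^ (3 * N) * norm (f z) ^ 3 \<and> norm (f z) ^ m * norm (\<psi> z) \<le> K' * r ^ (3 * N) * norm (f z))"
      using r by blast
  qed
  have "Q (z - c) = 0" using psiQ[of "z - c"] psi0 by simp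
  then show ?thesis by (simp add: Q_def L_def F_def s_def q_def)
qed

section \<open>Solving the linear equation\<close>

text \<open>The first-order expressions \<open>y' - b y\<close> and \<open>y' - a y\<close> are multiples of \<open>e\<^bsup>az\<^esup>\<close> and \<open>e\<^bsup>bz\<^esup>\<close>; subtracting them isolates
\<open>(a - b) y\<close>.\<close>

lemma second_order_linear_ode:
  fixes y0 y1 y2 :: "complex \<Rightarrow> complex"
  assumes d: "\<And>z. (y0 has_field_derivative y1 z) (at z)" "\<And>z. (y1 has_field_derivative y2 z) (at z)"
    and ode: "\<And>z. y2 z - (a + b) * y1 z + a * b * y0 z = 0" and ne: "a \<noteq> b"
  obtains A B where "\<And>z. y0 z = A * exp (a * z) + B * exp (b * z)"
proof -
  have first: "\<exists>C. \<forall>z. y1 z - b * y0 z = C * exp (a * z)" if o: "\<And>z. y2 z - (a + b) * y1 z + a * b * y0 z = 0" for a b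
  proof -
    have "((\<lambda>z. (y1 z - b * y0 z) * exp (- a * z)) has_field_derivative 0) (at z)" for z
    proof -
      have "((\<lambda>z. (y1 z - b * y0 z) * exp (- a * z)) has_field_derivative
          (y2 z - b * y1 z) * exp (- a * z) + (exp (- a * z) * - a) * (y1 z - b * y0 z)) (at z)"
        by (intro DERIV_mult DERIV_diff DERIV_cmult d) (auto intro!: derivative_eq_intros)
      also have "(y2 z - b * y1 z) * exp (- a * z) + (exp (- a * z) * - a) * (y1 z - b * y0 z)
          = (y2 z - (a + b) * y1 z + a * b * y0 z) * exp (- a * z)" by (simp add: algebra_simps)
      finally show ?thesis by (simp only: o mult_zero_left)
    qed
    then obtain C where "\<And>z. (y1 z - b * y0 z) * exp (- a * z) = C"
      using has_field_derivative_zero_constant[of UNIV "\<lambda>z. (y1 z - b * y0 z) * exp (- a * z)"] by auto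
    then have "y1 z - b * y0 z = C * exp (a * z)" for z
      by (metis (no_types, lifting) exp_minus_inverse mult.assoc mult.commute mult.right_neutral mult_minus_left)
    then show ?thesis by blast
  qed
  obtain C where C: "\<And>z. y1 z - b * y0 z = C * exp (a * z)" using first[of a b] ode by blast
  have "y2 z - (b + a) * y1 z + b * a * y0 z = 0" for z using ode[of z] by (simp add: add.commute mult.commute)
  then obtain D where D: "\<And>z. y1 z - a * y0 z = D * exp (b * z)" using first[of b a] by blast
  have "y0 z = C / (a - b) * exp (a * z) + (- D / (a - b)) * exp (b * z)" for z
  proof -
    have "(a - b) * y0 z = C * exp (a * z) - D * exp (b * z)"
      using C[of z] D[of z] by (simp add: algebra_simps)
    then have "y0 z = (C * exp (a * z) - D * exp (b * z)) / (a - b)"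
      using ne by (simp add: eq_divide_eq mult.commute)
    then show ?thesis by (simp add: diff_divide_distrib)
  qed
  then show ?thesis by (rule that)
qed

lemma poly_antiderivative:
  fixes q :: "complex poly"
  obtains Q where "pderiv Q = q"
proof -
  define Q where "Q = (\<Sum>i\<le>degree q. monom (coeff q i / of_nat (Suc i)) (Suc i))"
  have "coeff (pderiv Q) n = coeff q n" for n
  proof -
    have "coeff Q (Suc n) = (\<Sum>i\<le>degree q. if i = n then coeff q i / of_nat (Suc i) else 0)"
      by (simp add: Q_def coeff_sum)
    also have "\<dots> = (if n \<le> degree q then coeff q n / of_nat (Suc n) else 0)" by simp
    finally show ?thesis
      by (simp add: coeff_pderiv coeff_eq_0 del: of_nat_Suc)
  qed
  then show ?thesis by (intro that[of Q] poly_eqI)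
qed

lemma antiderivative_exponential_sum:
  fixes f :: "complex \<Rightarrow> complex"
  assumes "f holomorphic_on UNIV" and "a \<noteq> 0" "b \<noteq> 0"
    and "\<And>z. (deriv ^^ k) f z = A * exp (a * z) + B * exp (b * z)"
  shows "\<exists>q. \<forall>z. f z = A / a ^ k * exp (a * z) + B / b ^ k * exp (b * z) + poly q z"
  using assms(1,4)
proof (induction k arbitrary: f)
  case 0
  then show ?case by (intro exI[of _ 0]) simp
next
  case (Suc k)
  have "deriv f holomorphic_on UNIV" by (intro holomorphic_deriv Suc.prems) auto
  moreover have "(deriv ^^ k) (deriv f) z = A * exp (a * z) + B * exp (b * z)" for z
    using Suc.prems(2)[of z] by (simp add: funpow_Suc_right del: funpow.simps)
  ultimately obtain q where q: "\<And>z. deriv f z = A / a ^ k * exp (a * z) + B / b ^ k * exp (b * z) + poly q z"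
    using Suc.IH by blast
  obtain Q where Q: "pderiv Q = q" by (rule poly_antiderivative)
  define h where "h z = f z - (A / a ^ Suc k * exp (a * z) + B / b ^ Suc k * exp (b * z) + poly Q z)" for z
  have "(h has_field_derivative 0) (at z)" for z
  proof -
    have "(f has_field_derivative deriv f z) (at z)" using Suc.prems(1) by (simp add: holomorphic_derivI)
    then have "(h has_field_derivative deriv f z - (A / a ^ Suc k * (exp (a * z) * a) + B / b ^ Suc k * (exp (b * z) * b) + poly (pderiv Q) z)) (at z)"
      unfolding h_def by (auto intro!: derivative_eq_intros poly_DERIV simp: mult_ac)
    then show ?thesis using assms(2,3) by (simp add: q Q)
  qed
  then obtain C where "\<And>z. h z = C"
    using has_field_derivative_zero_constant[of UNIV h] by auto
  then have "f z = A / a ^ Suc k * exp (a * z) + B / b ^ Suc k * exp (b * z) + poly (Q + [:C:]) z" for z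
    unfolding h_def by (simp add: algebra_simps)
  then show ?case by blast
qed

section \<open>Comparing exponential sums along rays\<close>

text \<open>Induction on the polynomial: for the factor \<open>z\<close> gained in each step one half of the exponential is spent.\<close>

lemma exp_poly_tendsto_0_on_ray:
  fixes \<beta> v :: complex
  assumes "Re (\<beta> * v) < 0"
  shows "((\<lambda>t::real. poly p (of_real t * v) * exp (\<beta> * (of_real t * v))) \<longlongrightarrow> 0) at_top"
  using assms
proof (induction p arbitrary: \<beta>)
  case (pCons a p)
  define c where "c = Re (\<beta> * v)"
  have c: "c < 0" using pCons by (simp add: c_def)
  have n: "norm (exp (\<beta> * (of_real t * v))) = exp (c * t)"
    if "c = Re (\<beta> * v)" for \<beta> c t
  proof -
    have "\<beta> * (of_real t * v) = of_real t * (\<beta> * v)" by (rule mult.left_commute)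
    then show ?thesis
      by (simp only: norm_exp_eq_Re times_complex.sel(1)[of "of_real t" "\<beta> * v"] Re_complex_of_real Im_complex_of_real that)
         (simp add: mult.commute)
  qed
  have "((\<lambda>t. exp (c * t)) \<longlongrightarrow> 0) at_top" using c by real_asymp
  then have 1: "((\<lambda>t::real. exp (\<beta> * (of_real t * v))) \<longlongrightarrow> 0) at_top"
    by (subst tendsto_norm_zero_iff[symmetric]) (simp only: n[OF c_def])
  have half: "c / 2 = Re (\<beta> / 2 * v)" by (simp add: c_def)
  have "((\<lambda>t. t * exp (c / 2 * t)) \<longlongrightarrow> 0) at_top" using c by real_asymp
  then have "((\<lambda>t. \<bar>t * exp (c / 2 * t)\<bar>) \<longlongrightarrow> 0) at_top" by (rule tendsto_rabs_zero)
  then have 2: "((\<lambda>t::real. of_real t * exp (\<beta> / 2 * (of_real t * v))) \<longlongrightarrow> 0) at_top"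
    by (subst tendsto_norm_zero_iff[symmetric]) (simp only: norm_mult n[OF half] norm_of_real abs_mult abs_exp_cancel)
  have "((\<lambda>t::real. poly p (of_real t * v) * exp (\<beta> / 2 * (of_real t * v))) \<longlongrightarrow> 0) at_top"
    using c half by (intro pCons.IH) linarith
  from tendsto_add[OF tendsto_mult[OF tendsto_const[of a] 1] tendsto_mult[OF tendsto_const[of v] tendsto_mult[OF 2 this]]]
  have "((\<lambda>t::real. a * exp (\<beta> * (of_real t * v)) + v * (of_real t * exp (\<beta> / 2 * (of_real t * v)) *
      (poly p (of_real t * v) * exp (\<beta> / 2 * (of_real t * v))))) \<longlongrightarrow> 0) at_top" by simp
  moreover have "a * exp (\<beta> * (of_real t * v)) + v * (of_real t * exp (\<beta> / 2 * (of_real t * v)) *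
      (poly p (of_real t * v) * exp (\<beta> / 2 * (of_real t * v)))) =
      poly (pCons a p) (of_real t * v) * exp (\<beta> * (of_real t * v))" for t :: real
  proof -
    have "exp (\<beta> * (of_real t * v)) = exp (\<beta> / 2 * (of_real t * v)) * exp (\<beta> / 2 * (of_real t * v))"
      by (simp add: mult_ac flip: exp_add)
    then show ?thesis by (simp only: poly_pCons) (simp add: algebra_simps)
  qed
  ultimately show ?case by (simp only:)
qed simp

lemma exp_tendsto_0_on_ray:
  fixes \<beta> v :: complex
  assumes "Re (\<beta> * v) < 0"
  shows "((\<lambda>t::real. a * exp (\<beta> * (of_real t * v))) \<longlongrightarrow> 0) at_top"
  using exp_poly_tendsto_0_on_ray[OF assms, of "[:a:]"] by simp

text \<open>Let \<open>f\<close> behave like \<open>a e\<^bsup>\<gamma>z\<^esup>\<close> and \<open>g\<close> like \<open>b e\<^bsup>\<delta>z\<^esup>\<close> along the ray. If the product \<open>f\<^bsup>n-1\<^esup> g\<close> is an exponential sum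
of slower growth than \<open>e\<^bsup>((n-1)\<gamma> + \<delta>)z\<^esup>\<close>, its leading coefficient must vanish.\<close>

lemma dominant_exponents:
  fixes f g :: "complex \<Rightarrow> complex"
  assumes f: "((\<lambda>t::real. f (of_real t * v) * exp (- \<gamma> * (of_real t * v))) \<longlongrightarrow> a) at_top"
    and g: "((\<lambda>t::real. g (of_real t * v) * exp (- \<delta> * (of_real t * v))) \<longlongrightarrow> b) at_top"
    and eq: "\<And>z. f z ^ (n - 1) * g z = E1 * exp (\<alpha>1 * z) + E2 * exp (\<alpha>2 * z)"
    and small: "Re (\<alpha>1 * v) < real (n - 1) * Re (\<gamma> * v) + Re (\<delta> * v)"
      "Re (\<alpha>2 * v) < real (n - 1) * Re (\<gamma> * v) + Re (\<delta> * v)"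
  shows "a ^ (n - 1) * b = 0"
proof -
  define \<epsilon> where "\<epsilon> = of_nat (n - 1) * \<gamma> + \<delta>"
  have re: "Re (\<epsilon> * v) = real (n - 1) * Re (\<gamma> * v) + Re (\<delta> * v)"
    by (simp add: \<epsilon>_def algebra_simps)
  have "((\<lambda>t::real. E1 * exp ((\<alpha>1 - \<epsilon>) * (of_real t * v)) + E2 * exp ((\<alpha>2 - \<epsilon>) * (of_real t * v))) \<longlongrightarrow> 0 + 0) at_top"
    using small re by (intro tendsto_add exp_tendsto_0_on_ray) (simp_all only: left_diff_distrib minus_complex.sel)
  moreover have "((\<lambda>t::real. (f (of_real t * v) * exp (- \<gamma> * (of_real t * v))) ^ (n - 1) *
      (g (of_real t * v) * exp (- \<delta> * (of_real t * v)))) \<longlongrightarrow> a ^ (n - 1) * b) at_top"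
    by (intro tendsto_mult tendsto_power f g)
  moreover have "(f z * exp (- \<gamma> * z)) ^ (n - 1) * (g z * exp (- \<delta> * z))
      = E1 * exp ((\<alpha>1 - \<epsilon>) * z) + E2 * exp ((\<alpha>2 - \<epsilon>) * z)" for z
  proof -
    have "exp (- \<gamma> * z) ^ (n - 1) * exp (- \<delta> * z) = exp (- \<epsilon> * z)"
      unfolding exp_of_nat_mult[symmetric] exp_add[symmetric] by (simp add: \<epsilon>_def algebra_simps)
    then have "(f z * exp (- \<gamma> * z)) ^ (n - 1) * (g z * exp (- \<delta> * z)) = (f z ^ (n - 1) * g z) * exp (- \<epsilon> * z)"
      by (simp add: power_mult_distrib mult_ac)
    also have "\<dots> = E1 * (exp (\<alpha>1 * z) * exp (- \<epsilon> * z)) + E2 * (exp (\<alpha>2 * z) * exp (- \<epsilon> * z))"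
      unfolding eq by (simp add: algebra_simps)
    also have "\<dots> = E1 * exp ((\<alpha>1 - \<epsilon>) * z) + E2 * exp ((\<alpha>2 - \<epsilon>) * z)"
      unfolding exp_add[symmetric] by (simp add: algebra_simps)
    finally show ?thesis .
  qed
  ultimately show ?thesis using tendsto_unique[OF trivial_limit_at_top_linorder] by fastforce
qed

lemma exponential_sum_leading_term:
  fixes A B \<alpha>1 \<alpha>2 v :: complex
  assumes "Re (\<alpha>1 * v) > 0" "Re (\<alpha>2 * v) < Re (\<alpha>1 * v) \<or> B = 0"
  shows "((\<lambda>t::real. (A * exp (\<alpha>1 * (of_real t * v)) + B * exp (\<alpha>2 * (of_real t * v)) + poly q (of_real t * v)) *
     exp (- \<alpha>1 * (of_real t * v))) \<longlongrightarrow> A) at_top"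
proof -
  have "((\<lambda>t::real. A + B * exp ((\<alpha>2 - \<alpha>1) * (of_real t * v)) + poly q (of_real t * v) * exp (- \<alpha>1 * (of_real t * v)))
     \<longlongrightarrow> A + 0 + 0) at_top"
  proof (intro tendsto_add tendsto_const exp_poly_tendsto_0_on_ray)
    show "((\<lambda>t::real. B * exp ((\<alpha>2 - \<alpha>1) * (of_real t * v))) \<longlongrightarrow> 0) at_top"
    proof (cases "B = 0")
      case False
      then show ?thesis using assms by (intro exp_tendsto_0_on_ray) (simp add: algebra_simps)
    qed simp
  qed (use assms in simp)
  moreover have "A + B * exp ((\<alpha>2 - \<alpha>1) * x) + y * exp (- \<alpha>1 * x)
      = (A * exp (\<alpha>1 * x) + B * exp (\<alpha>2 * x) + y) * exp (- \<alpha>1 * x)" for x y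
    by (simp add: distrib_right mult.assoc flip: exp_add) (simp add: algebra_simps)
  ultimately show ?thesis by simp
qed

text \<open>Along a ray on which \<open>\<alpha>\<^sub>1\<close> dominates, the left-hand side has the leading term \<open>A\<^sup>n (1 + w \<alpha>\<^sub>1) e\<^bsup>n\<alpha>\<^sub>1z\<^esup>\<close>, which the
right-hand side cannot match because \<open>n \<ge> 2\<close>. The second factor on the left is \<open>f + w f'\<close>.\<close>

lemma dominant_exponent_resonance:
  fixes A B w \<alpha>1 \<alpha>2 v :: complex
  assumes n: "n \<ge> 2" and A: "A \<noteq> 0"
    and v: "Re (\<alpha>1 * v) > 0" "Re (\<alpha>2 * v) < Re (\<alpha>1 * v)"
    and eq: "\<And>z. (A * exp (\<alpha>1 * z) + B * exp (\<alpha>2 * z) + poly q z) ^ (n - 1) *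
       ((1 + w * \<alpha>1) * A * exp (\<alpha>1 * z) + (1 + w * \<alpha>2) * B * exp (\<alpha>2 * z) + poly s z)
       = E1 * exp (\<alpha>1 * z) + E2 * exp (\<alpha>2 * z)"
  shows "1 + w * \<alpha>1 = 0"
proof -
  have "1 * Re (\<alpha>1 * v) \<le> real (n - 1) * Re (\<alpha>1 * v)" using n v by (intro mult_right_mono) auto
  then have s: "Re (\<alpha>1 * v) < real (n - 1) * Re (\<alpha>1 * v) + Re (\<alpha>1 * v)"
      "Re (\<alpha>2 * v) < real (n - 1) * Re (\<alpha>1 * v) + Re (\<alpha>1 * v)" using v by linarith+
  have "A ^ (n - 1) * ((1 + w * \<alpha>1) * A) = 0"
    by (rule dominant_exponents[OF exponential_sum_leading_term[OF v(1) disjI1[OF v(2)]]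
          exponential_sum_leading_term[OF v(1) disjI1[OF v(2)]] eq s])
  then show ?thesis using A by simp
qed

text \<open>Unless \<open>b\<close> lies on the open segment from 0 to \<open>a\<close>, it is a vertex of the triangle with vertices \<open>0\<close>, \<open>a\<close>, \<open>b\<close>, and
some direction singles it out.\<close>

lemma separating_ray:
  fixes a b :: complex
  assumes a: "a \<noteq> 0" and ne: "b \<noteq> 0" "a \<noteq> b" and nb: "\<not> (\<exists>x::real. 0 < x \<and> x < 1 \<and> b = of_real x * a)"
  obtains v where "Re (b * v) > 0" "Re (a * v) < Re (b * v)"
proof -
  note goal = that
  define \<beta> where "\<beta> = b / a"
  have b: "b = \<beta> * a" using a by (simp add: \<beta>_def)
  have sep: thesis if "Re (\<beta> * u) > 0" "Re u < Re (\<beta> * u)" for u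
    by (rule goal[of "u / a"]) (use that a in \<open>simp_all add: b\<close>)
  show thesis
  proof (cases "Im \<beta> = 0")
    case False
    then have "Im \<beta> * Im \<beta> > 0" by (simp add: zero_less_mult_iff) linarith
    then show thesis by (intro sep[of "Complex 0 (- Im \<beta>)"]) auto
  next
    case True
    then have br: "\<beta> = of_real (Re \<beta>)" by (simp add: complex_eq_iff)
    have "Re \<beta> \<noteq> 0" using b ne(1) br by auto
    moreover have "Re \<beta> \<noteq> 1" using b ne(2) br by (metis mult_1 of_real_1)
    moreover have "\<not> (0 < Re \<beta> \<and> Re \<beta> < 1)" using nb b br by metis
    ultimately have "Re \<beta> < 0 \<or> Re \<beta> > 1" by linarith
    then show thesis
    proof
      assume "Re \<beta> < 0" then show thesis by (intro sep[of "-1"]) auto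
    next
      assume "Re \<beta> > 1" then show thesis by (intro sep[of 1]) auto
    qed
  qed
qed

text \<open>In the direction of \<open>cnj \<alpha>\<^sub>1\<close> the exponent \<open>\<alpha>\<^sub>1\<close> dominates, so \<open>1 + w \<alpha>\<^sub>1 = 0\<close> and the term with \<open>\<alpha>\<^sub>1\<close> drops out of
\<open>f + w f'\<close>. For \<open>\<alpha>\<^sub>2\<close> the same conclusion is then impossible, which leaves only \<open>\<alpha>\<^sub>2 = x \<alpha>\<^sub>1\<close> with \<open>0 < x < 1\<close>. In this case
the left-hand side grows along \<open>1/\<alpha>\<^sub>1\<close> like \<open>e\<^bsup>(n-1+x)t\<^esup>\<close>, and \<open>n - 1 + x > 1\<close>.\<close>

lemma not_both_exponentials:
  fixes A B w \<alpha>1 \<alpha>2 :: complex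
  assumes n: "n \<ge> 2" and AB: "A \<noteq> 0" "B \<noteq> 0" and \<alpha>: "\<alpha>1 \<noteq> 0" "\<alpha>2 \<noteq> 0" "\<alpha>1 \<noteq> \<alpha>2"
    and le: "norm \<alpha>2 \<le> norm \<alpha>1"
    and eq: "\<And>z. (A * exp (\<alpha>1 * z) + B * exp (\<alpha>2 * z) + poly q z) ^ (n - 1) *
       ((1 + w * \<alpha>1) * A * exp (\<alpha>1 * z) + (1 + w * \<alpha>2) * B * exp (\<alpha>2 * z) + poly s z)
       = E1 * exp (\<alpha>1 * z) + E2 * exp (\<alpha>2 * z)"
  shows False
proof -
  have "Re (\<alpha>1 * cnj \<alpha>1) > 0 \<and> Re (\<alpha>2 * cnj \<alpha>1) < Re (\<alpha>1 * cnj \<alpha>1)"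
  proof -
    have 0: "Re (\<alpha>1 * cnj \<alpha>1) = (norm \<alpha>1)^2" 
      by (simp only: cmod_power2 times_complex.sel cnj.sel) (simp add: power2_eq_square)
    have "(norm (\<alpha>1 - \<alpha>2))^2 = (norm \<alpha>1)^2 + (norm \<alpha>2)^2 - 2 * Re (\<alpha>2 * cnj \<alpha>1)"
      by (simp only: cmod_power2 minus_complex.sel times_complex.sel cnj.sel) (simp add: power2_eq_square algebra_simps)
    moreover have "(norm (\<alpha>1 - \<alpha>2))^2 > 0" using \<alpha> by simp
    moreover have "(norm \<alpha>2)^2 \<le> (norm \<alpha>1)^2" using le by (intro power_mono) auto
    ultimately have "Re (\<alpha>2 * cnj \<alpha>1) < (norm \<alpha>1)^2" by linarith
    then show ?thesis unfolding 0 using \<alpha>(1) by simp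
  qed
  then have w1: "1 + w * \<alpha>1 = 0" using dominant_exponent_resonance[OF n AB(1) _ _ eq] by blast
  then have w2: "1 + w * \<alpha>2 \<noteq> 0" using \<alpha>(3)
    by (metis add_left_cancel mult_cancel_left mult_zero_left add.right_neutral zero_neq_one)
  have "\<exists>x::real. 0 < x \<and> x < 1 \<and> \<alpha>2 = of_real x * \<alpha>1"
  proof (rule ccontr)
    assume "\<not> ?thesis"
    then obtain v where v: "Re (\<alpha>2 * v) > 0" "Re (\<alpha>1 * v) < Re (\<alpha>2 * v)"
      using separating_ray[OF \<alpha>] by metis
    have "(B * exp (\<alpha>2 * z) + A * exp (\<alpha>1 * z) + poly q z) ^ (n - 1) *
       ((1 + w * \<alpha>2) * B * exp (\<alpha>2 * z) + (1 + w * \<alpha>1) * A * exp (\<alpha>1 * z) + poly s z)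
       = E2 * exp (\<alpha>2 * z) + E1 * exp (\<alpha>1 * z)" for z
      using eq[of z] by (simp add: add_ac)
    from dominant_exponent_resonance[OF n AB(2) v this] w2 show False by blast
  qed
  then obtain x :: real where x: "0 < x" "x < 1" "\<alpha>2 = of_real x * \<alpha>1" by blast
  define v where "v = inverse \<alpha>1"
  have "\<alpha>1 * v = 1" "\<alpha>2 * v = of_real x" using \<alpha>(1) by (simp_all add: v_def x(3))
  then have v1: "Re (\<alpha>1 * v) = 1" and v2: "Re (\<alpha>2 * v) = x" by (simp_all only: one_complex.sel Re_complex_of_real)
  have f: "((\<lambda>t::real. (A * exp (\<alpha>1 * (of_real t * v)) + B * exp (\<alpha>2 * (of_real t * v)) + poly q (of_real t * v)) *
     exp (- \<alpha>1 * (of_real t * v))) \<longlongrightarrow> A) at_top"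
    by (rule exponential_sum_leading_term) (use v1 v2 x in auto)
  have g: "((\<lambda>t::real. ((1 + w * \<alpha>1) * A * exp (\<alpha>1 * (of_real t * v)) + (1 + w * \<alpha>2) * B * exp (\<alpha>2 * (of_real t * v)) + poly s (of_real t * v)) *
     exp (- \<alpha>2 * (of_real t * v))) \<longlongrightarrow> (1 + w * \<alpha>2) * B) at_top"
  proof -
    have "Re (\<alpha>2 * v) > 0" using v2 x by simp
    from exponential_sum_leading_term[OF this disjI2[OF refl], where A = "(1 + w * \<alpha>2) * B" and q = s and ?\<alpha>2.0 = \<alpha>1]
    show ?thesis unfolding w1 by simp
  qed
  have "real (n - 1) \<ge> 1" using n by simp
  then have "A ^ (n - 1) * ((1 + w * \<alpha>2) * B) = 0"
    using dominant_exponents[OF f g eq] v1 v2 x n by auto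
  then show False using AB w2 by simp
qed

text \<open>If \<open>q \<noteq> 0\<close>, take a ray on which \<open>e\<^bsup>\<alpha>\<^sub>1z\<^esup>\<close> decays and \<open>|e\<^bsup>\<alpha>\<^sub>2z\<^esup>|\<close> is not constant. The left-hand side is
asymptotic to the non-zero polynomial \<open>q\<^bsup>n-1\<^esup> s\<close> there, whereas the right-hand side either tends to 0 or grows
exponentially.\<close>

lemma polynomial_part_vanishes:
  fixes A w \<alpha>1 \<alpha>2 :: complex
  assumes \<alpha>: "\<alpha>1 \<noteq> 0" "\<alpha>2 \<noteq> 0" and E2: "E2 \<noteq> 0"
    and s: "s = q + smult w (pderiv q)"
    and eq: "\<And>z. (A * exp (\<alpha>1 * z) + poly q z) ^ (n - 1) * (A' * exp (\<alpha>1 * z) + poly s z)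
       = E1 * exp (\<alpha>1 * z) + E2 * exp (\<alpha>2 * z)"
  shows "q = 0"
proof (rule ccontr)
  assume q: "q \<noteq> 0"
  have "coeff s (degree q) = lead_coeff q"
    by (simp add: s coeff_pderiv coeff_eq_0)
  then have s0: "s \<noteq> 0" using q by auto
  define Q where "Q = q ^ (n - 1) * s"
  have Q: "Q \<noteq> 0" using q s0 by (simp add: Q_def)
  obtain v where v: "Re (\<alpha>1 * v) < 0" "Re (\<alpha>2 * v) \<noteq> 0"
  proof (cases "Re (\<alpha>2 / \<alpha>1) = 0")
    case False
    then show thesis using \<alpha> by (intro that[of "- 1 / \<alpha>1"]) auto
  next
    case True
    have "\<alpha>2 / \<alpha>1 \<noteq> 0" using \<alpha> by simp
    then have im: "Im (\<alpha>2 / \<alpha>1) \<noteq> 0" using True by (simp add: complex_eq_iff)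
    have rot: "Re (- \<xi> * (1 + \<i>)) = Im \<xi> - Re \<xi>" for \<xi> by simp
    show thesis
    proof (rule that[of "- (1 + \<i>) / \<alpha>1"])
      show "Re (\<alpha>1 * (- (1 + \<i>) / \<alpha>1)) < 0" using \<alpha> by simp
      have "\<alpha>2 * (- (1 + \<i>) / \<alpha>1) = - (\<alpha>2 / \<alpha>1) * (1 + \<i>)"
        using \<alpha> by (simp add: field_simps)
      then have "Re (\<alpha>2 * (- (1 + \<i>) / \<alpha>1)) = Im (\<alpha>2 / \<alpha>1) - Re (\<alpha>2 / \<alpha>1)"
        using rot[of "\<alpha>2 / \<alpha>1"] by (simp only:)
      then show "Re (\<alpha>2 * (- (1 + \<i>) / \<alpha>1)) \<noteq> 0" using True im by simp
    qed
  qed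
  have v0: "v \<noteq> 0" using v by auto
  have away: "\<exists>\<delta>>0. eventually (\<lambda>t::real. norm (poly p (of_real t * v)) \<ge> \<delta>) at_top" if p: "p \<noteq> 0" for p
  proof -
    obtain \<delta> r where \<delta>: "\<delta> > 0" "\<And>z. norm z \<ge> r \<Longrightarrow> norm (poly p z) \<ge> \<delta>"
      using poly_bounded_away_from_0[OF p] by metis
    have "eventually (\<lambda>t::real. t \<ge> max 0 (r / norm v)) at_top" by (rule eventually_ge_at_top)
    then have "eventually (\<lambda>t::real. norm (poly p (of_real t * v)) \<ge> \<delta>) at_top"
    proof eventually_elim
      case (elim t)
      then have "r \<le> norm (of_real t * v)" using v0 by (simp add: norm_mult field_simps)
      then show ?case by (rule \<delta>(2))
    qed
    then show ?thesis using \<delta>(1) by blast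
  qed
  have div0: "((\<lambda>t::real. h t / poly p (of_real t * v)) \<longlongrightarrow> 0) at_top"
    if h: "(h \<longlongrightarrow> 0) at_top" and p: "p \<noteq> 0" for h p
  proof -
    obtain \<delta> where \<delta>: "\<delta> > 0" "eventually (\<lambda>t::real. norm (poly p (of_real t * v)) \<ge> \<delta>) at_top"
      using away[OF p] by blast
    show ?thesis
    proof (rule Lim_null_comparison)
      show "eventually (\<lambda>t. norm (h t / poly p (of_real t * v)) \<le> norm (h t) / \<delta>) at_top"
        using \<delta>(2)
      proof eventually_elim
        case (elim t)
        then show ?case unfolding norm_divide using \<delta>(1) by (intro divide_left_mono mult_pos_pos) auto
      qed
      show "((\<lambda>t. norm (h t) / \<delta>) \<longlongrightarrow> 0) at_top"
        using tendsto_divide[OF tendsto_norm[OF h] tendsto_const[of \<delta>]] \<delta>(1) by simp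
    qed
  qed
  have nz: "eventually (\<lambda>t::real. poly p (of_real t * v) \<noteq> 0) at_top" if "p \<noteq> 0" for p
    using away[OF that] by (auto elim: eventually_mono)
  have ratio: "((\<lambda>t::real. (C * exp (\<alpha>1 * (of_real t * v)) + poly p (of_real t * v)) / poly p (of_real t * v)) \<longlongrightarrow> 1) at_top"
    if p: "p \<noteq> 0" for C p
  proof (rule Lim_transform_eventually)
    show "((\<lambda>t::real. C * exp (\<alpha>1 * (of_real t * v)) / poly p (of_real t * v) + 1) \<longlongrightarrow> 1) at_top"
      using tendsto_add[OF div0[OF exp_tendsto_0_on_ray[OF v(1)] p] tendsto_const[of 1]] by simp
    show "eventually (\<lambda>t::real. C * exp (\<alpha>1 * (of_real t * v)) / poly p (of_real t * v) + 1 =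
      (C * exp (\<alpha>1 * (of_real t * v)) + poly p (of_real t * v)) / poly p (of_real t * v)) at_top"
      using nz[OF p] by eventually_elim (simp add: add_divide_distrib)
  qed
  define RHS where "RHS t = E1 * exp (\<alpha>1 * (of_real t * v)) + E2 * exp (\<alpha>2 * (of_real t * v))" for t :: real
  have "((\<lambda>t::real. ((A * exp (\<alpha>1 * (of_real t * v)) + poly q (of_real t * v)) / poly q (of_real t * v)) ^ (n - 1) *
      ((A' * exp (\<alpha>1 * (of_real t * v)) + poly s (of_real t * v)) / poly s (of_real t * v))) \<longlongrightarrow> 1 ^ (n - 1) * 1) at_top"
    by (intro tendsto_mult tendsto_power ratio q s0)
  moreover have "((A * exp (\<alpha>1 * z) + poly q z) / poly q z) ^ (n - 1) * ((A' * exp (\<alpha>1 * z) + poly s z) / poly s z)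
      = (E1 * exp (\<alpha>1 * z) + E2 * exp (\<alpha>2 * z)) / poly Q z" for z
    by (simp add: Q_def poly_power power_divide flip: eq)
  ultimately have lim1: "((\<lambda>t. RHS t / poly Q (of_real t * v)) \<longlongrightarrow> 1) at_top" by (simp add: RHS_def)
  show False
  proof (cases "Re (\<alpha>2 * v) < 0")
    case True
    have "(RHS \<longlongrightarrow> 0 + 0) at_top" unfolding RHS_def
      by (intro tendsto_add exp_tendsto_0_on_ray v True)
    then have "((\<lambda>t. RHS t / poly Q (of_real t * v)) \<longlongrightarrow> 0) at_top" using div0[OF _ Q] by simp
    from tendsto_unique[OF trivial_limit_at_top_linorder lim1 this] show False by simp
  next
    case False
    then have pos: "Re (\<alpha>2 * v) > 0" using v(2) by linarith
    have "((\<lambda>t. RHS t / poly Q (of_real t * v) * (poly Q (of_real t * v) * exp (- \<alpha>2 * (of_real t * v)))) \<longlongrightarrow> 1 * 0) at_top"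
      by (intro tendsto_mult lim1 exp_poly_tendsto_0_on_ray) (use pos in simp)
    moreover have "eventually (\<lambda>t. RHS t / poly Q (of_real t * v) * (poly Q (of_real t * v) * exp (- \<alpha>2 * (of_real t * v)))
        = (E2 * exp (\<alpha>2 * (of_real t * v)) + E1 * exp (\<alpha>1 * (of_real t * v)) + poly 0 (of_real t * v)) * exp (- \<alpha>2 * (of_real t * v))) at_top"
      using nz[OF Q] by eventually_elim (simp add: RHS_def add.commute)
    ultimately have "((\<lambda>t::real. (E2 * exp (\<alpha>2 * (of_real t * v)) + E1 * exp (\<alpha>1 * (of_real t * v)) + poly 0 (of_real t * v)) * exp (- \<alpha>2 * (of_real t * v))) \<longlongrightarrow> 1 * 0) at_top"
      by (rule Lim_transform_eventually)
    moreover have "((\<lambda>t::real. (E2 * exp (\<alpha>2 * (of_real t * v)) + E1 * exp (\<alpha>1 * (of_real t * v)) + poly 0 (of_real t * v)) * exp (- \<alpha>2 * (of_real t * v))) \<longlongrightarrow> E2) at_top"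
      by (rule exponential_sum_leading_term) (use pos v in auto)
    ultimately have "E2 = 1 * 0" by (rule tendsto_unique[OF trivial_limit_at_top_linorder, rotated])
    then show False using E2 by simp
  qed
qed

text \<open>The equation and its first two derivatives at 0 form a Vandermonde system.\<close>

lemma exponential_relation:
  fixes a b d :: complex
  assumes eq: "\<And>z. X * exp (b * z) = E1 * exp (a * z) + E2 * exp (d * z)"
    and E2: "E2 \<noteq> 0" and ne: "b \<noteq> a" "d \<noteq> a"
  shows "b = d" and "X = E2"
proof -
  have D: "b * X * exp (b * z) = a * E1 * exp (a * z) + d * E2 * exp (d * z)"
    if "\<And>z. X * exp (b * z) = E1 * exp (a * z) + E2 * exp (d * z)" for X E1 E2 z
  proof -
    have "((\<lambda>z. X * exp (b * z)) has_field_derivative b * X * exp (b * z)) (at z)"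
      by (auto intro!: derivative_eq_intros)
    moreover have "((\<lambda>z. X * exp (b * z)) has_field_derivative a * E1 * exp (a * z) + d * E2 * exp (d * z)) (at z)"
      unfolding that by (auto intro!: derivative_eq_intros)
    ultimately show ?thesis by (rule DERIV_unique)
  qed
  have d0: "X = E1 + E2" using eq[of 0] by simp
  have d1: "b * X = a * E1 + d * E2" using D[OF eq, of 0] by simp
  have d2: "b * (b * X) = a * (a * E1) + d * (d * E2)" using D[OF D[OF eq], of 0] by simp
  have "E2 * ((d - b) * (d - a)) = (a * (a * E1) + d * (d * E2)) - (a + b) * (a * E1 + d * E2) + a * b * (E1 + E2)"
    by (simp add: algebra_simps)
  also have "\<dots> = 0" unfolding d0[symmetric] d1[symmetric] d2[symmetric] by (simp add: algebra_simps)
  finally show bd: "b = d" using E2 ne by simp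
  have "(X - E2) * (d - a) = 0" using d0 d1 bd by (simp add: algebra_simps)
  then show "X = E2" using ne by simp
qed

text \<open>With \<open>q = 0\<close> the equation reduces to \<open>(1 + w \<alpha>\<^sub>1) A\<^sup>n e\<^bsup>n\<alpha>\<^sub>1z\<^esup> = E\<^sub>1 e\<^bsup>\<alpha>\<^sub>1z\<^esup> + p\<^sub>2 e\<^bsup>\<alpha>\<^sub>2z\<^esup>\<close>, and comparing exponents forces
\<open>n \<alpha>\<^sub>1 = \<alpha>\<^sub>2\<close>. Any \<open>n\<close>-th root \<open>u\<close> of \<open>1 + w \<alpha>\<^sub>1\<close> may be chosen; then \<open>v = u A\<close>.\<close>

lemma single_exponential_solution:
  fixes A w \<alpha>1 \<alpha>2 :: complex
  assumes n: "n \<ge> 2" and \<alpha>: "\<alpha>1 \<noteq> 0" "\<alpha>2 \<noteq> 0" "\<alpha>1 \<noteq> \<alpha>2" and A: "A \<noteq> 0" and p2: "p2 \<noteq> 0"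
    and f: "\<And>z. f z = A * exp (\<alpha>1 * z) + poly q z"
    and eq: "\<And>z. f z ^ (n - 1) * ((1 + w * \<alpha>1) * A * exp (\<alpha>1 * z) + poly (q + smult w (pderiv q)) z)
       = E1 * exp (\<alpha>1 * z) + p2 * exp (\<alpha>2 * z)"
  shows "\<exists>a C. a \<noteq> 0 \<and> C \<noteq> 0 \<and> (\<forall>z. f z = C * exp (a * z)) \<and> a = \<alpha>1 \<and> of_nat n * a = \<alpha>2 \<and>
     1 + a * w \<noteq> 0 \<and> (\<exists>u v. u ^ n = 1 + a * w \<and> v ^ n = p2 \<and> C = inverse u * v)"
proof -
  have q: "q = 0"
    by (rule polynomial_part_vanishes[OF \<alpha>(1,2) p2 refl eq[unfolded f]])
  have "(1 + w * \<alpha>1) * A ^ n * exp (of_nat n * \<alpha>1 * z) = E1 * exp (\<alpha>1 * z) + p2 * exp (\<alpha>2 * z)" for z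
  proof -
    have "f z ^ (n - 1) * ((1 + w * \<alpha>1) * A * exp (\<alpha>1 * z)) = (1 + w * \<alpha>1) * (f z ^ (n - 1) * f z)"
      by (simp add: f q)
    also have "f z ^ (n - 1) * f z = f z ^ n" using power_minus_mult[of n "f z"] n by simp
    also have "f z ^ n = A ^ n * exp (of_nat n * \<alpha>1 * z)"
      by (simp add: f q power_mult_distrib mult.assoc flip: exp_of_nat_mult)
    finally have "f z ^ (n - 1) * ((1 + w * \<alpha>1) * A * exp (\<alpha>1 * z)) = (1 + w * \<alpha>1) * (A ^ n * exp (of_nat n * \<alpha>1 * z))" .
    moreover have "f z ^ (n - 1) * ((1 + w * \<alpha>1) * A * exp (\<alpha>1 * z)) = E1 * exp (\<alpha>1 * z) + p2 * exp (\<alpha>2 * z)"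
      using eq[of z] by (simp add: q)
    ultimately show ?thesis by (metis mult.assoc)
  qed
  note rel = exponential_relation[OF this p2]
  have "of_nat n \<noteq> (1 :: complex)" using n of_nat_eq_1_iff[of n, where 'a = complex] by auto
  then have "of_nat n * \<alpha>1 \<noteq> \<alpha>1" using \<alpha>(1) by simp
  then have n\<alpha>: "of_nat n * \<alpha>1 = \<alpha>2" and X: "(1 + w * \<alpha>1) * A ^ n = p2"
    using rel \<alpha>(3) by auto
  have w: "1 + \<alpha>1 * w \<noteq> 0" using X p2 by (auto simp: mult.commute)
  obtain u where u: "1 + \<alpha>1 * w = u ^ n" using exists_complex_root[of n "1 + \<alpha>1 * w"] n by auto
  have "u \<noteq> 0" using u w n by (auto simp: power_0_left)
  moreover have "(u * A) ^ n = p2" using X by (simp add: power_mult_distrib mult.commute flip: u)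
  ultimately have "\<exists>u v. u ^ n = 1 + \<alpha>1 * w \<and> v ^ n = p2 \<and> A = inverse u * v"
    using u by (intro exI[of _ u] exI[of _ "u * A"]) auto
  then show ?thesis using A \<alpha> f q n\<alpha> w by (intro exI[of _ \<alpha>1] exI[of _ A]) auto
qed

theorem theorem2:
  fixes n k :: nat
    and c w :: complex
    and p \<alpha> :: "nat \<Rightarrow> complex"
    and f :: "complex \<Rightarrow> complex"
  assumes "n \<ge> 5"
    and "w \<noteq> 0" and "p 1 \<noteq> 0" and "p 2 \<noteq> 0" and "\<alpha> 1 \<noteq> 0" and "\<alpha> 2 \<noteq> 0"
    and "\<alpha> 1 \<noteq> \<alpha> 2"
    and "transcendental_entire f"
    and "finite_order f"
    and "\<And>z. f z ^ n + w * f z ^ (n - 1) * deriv f z + (deriv ^^ k) f (z + c)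
               = p 1 * exp (\<alpha> 1 * z) + p 2 * exp (\<alpha> 2 * z)"
  shows "\<exists>a C. a \<noteq> 0 \<and> C \<noteq> 0 \<and> (\<forall>z. f z = C * exp (a * z)) \<and>
           (\<exists>i\<in>{1, 2}. \<exists>j\<in>{1, 2}. i \<noteq> j \<and> a = \<alpha> i \<and> of_nat n * a = \<alpha> j \<and>
              1 + a * w \<noteq> 0 \<and>
              (\<exists>u v. u ^ n = 1 + a * w \<and> v ^ n = p j \<and> C = inverse u * v))"
proof -
  note \<alpha> = assms(5-7) and eq = assms(10)
  have f: "f holomorphic_on UNIV" and nonpoly: "\<not> (\<exists>q. \<forall>z. f z = poly q z)"
    using assms(8) by (auto simp: transcendental_entire_def)
  have n: "n \<ge> 2" using assms(1) by simp
  obtain A B where exp_type: "A \<ge> 0" "B \<ge> 0" "\<And>z. norm (f z) \<le> exp (A * norm z + B)"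
    using equation_exponential_type[OF n assms(2) f assms(9) eq] by metis
  have "(deriv ^^ Suc (Suc k)) f z - (\<alpha> 1 + \<alpha> 2) * (deriv ^^ Suc k) f z + \<alpha> 1 * \<alpha> 2 * (deriv ^^ k) f z = 0" for z
    using linear_part_annihilated[OF assms(1) f nonpoly exp_type eq, of z] by (simp add: numeral_2_eq_2)
  then obtain A B where AB: "\<And>z. (deriv ^^ k) f z = A * exp (\<alpha> 1 * z) + B * exp (\<alpha> 2 * z)"
    using second_order_linear_ode[OF higher_deriv_has_field_derivative[OF f] higher_deriv_has_field_derivative[OF f] _ \<alpha>(3)]
    by metis
  define A1 A2 where "A1 = A / \<alpha> 1 ^ k" and "A2 = B / \<alpha> 2 ^ k"
  obtain q where fz: "\<And>z. f z = A1 * exp (\<alpha> 1 * z) + A2 * exp (\<alpha> 2 * z) + poly q z"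
    using antiderivative_exponential_sum[OF f \<alpha>(1,2) AB] unfolding A1_def A2_def by blast
  define s where "s = q + smult w (pderiv q)"
  define E1 E2 where "E1 = p 1 - A * exp (\<alpha> 1 * c)" and "E2 = p 2 - B * exp (\<alpha> 2 * c)"
  have deriv_f: "deriv f z = A1 * \<alpha> 1 * exp (\<alpha> 1 * z) + A2 * \<alpha> 2 * exp (\<alpha> 2 * z) + poly (pderiv q) z" for z
  proof (rule DERIV_imp_deriv)
    have "((\<lambda>z. A1 * exp (\<alpha> 1 * z) + A2 * exp (\<alpha> 2 * z) + poly q z) has_field_derivative
       A1 * \<alpha> 1 * exp (\<alpha> 1 * z) + A2 * \<alpha> 2 * exp (\<alpha> 2 * z) + poly (pderiv q) z) (at z)"
      by (auto intro!: derivative_eq_intros poly_DERIV simp: mult_ac)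
    moreover have "f = (\<lambda>z. A1 * exp (\<alpha> 1 * z) + A2 * exp (\<alpha> 2 * z) + poly q z)" by (rule ext) (rule fz)
    ultimately show "(f has_field_derivative A1 * \<alpha> 1 * exp (\<alpha> 1 * z) + A2 * \<alpha> 2 * exp (\<alpha> 2 * z) + poly (pderiv q) z) (at z)"
      by (simp only:)
  qed
  have feq: "f z ^ (n - 1) * ((1 + w * \<alpha> 1) * A1 * exp (\<alpha> 1 * z) + (1 + w * \<alpha> 2) * A2 * exp (\<alpha> 2 * z) + poly s z)
       = E1 * exp (\<alpha> 1 * z) + E2 * exp (\<alpha> 2 * z)" for z
  proof -
    have u: "(1 + w * \<alpha> 1) * A1 * exp (\<alpha> 1 * z) + (1 + w * \<alpha> 2) * A2 * exp (\<alpha> 2 * z) + poly s z = f z + w * deriv f z"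
      unfolding deriv_f s_def by (subst fz) (simp add: algebra_simps)
    have "f z ^ n = f z ^ (n - 1) * f z" using power_minus_mult[of n "f z"] n by simp
    then have "f z ^ (n - 1) * (f z + w * deriv f z) = f z ^ n + w * f z ^ (n - 1) * deriv f z"
      by (simp only: distrib_left) (simp add: mult_ac)
    also have "\<dots> = p 1 * exp (\<alpha> 1 * z) + p 2 * exp (\<alpha> 2 * z) - (deriv ^^ k) f (z + c)"
      using eq[of z] by (simp only: eq_diff_eq)
    also have "(deriv ^^ k) f (z + c) = A * exp (\<alpha> 1 * c) * exp (\<alpha> 1 * z) + B * exp (\<alpha> 2 * c) * exp (\<alpha> 2 * z)"
      unfolding AB by (simp add: distrib_left exp_add)
    finally show ?thesis unfolding u E1_def E2_def by (simp add: left_diff_distrib)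
  qed
  have A1_0: "A1 = 0 \<longleftrightarrow> A = 0" and A2_0: "A2 = 0 \<longleftrightarrow> B = 0" using \<alpha> by (auto simp: A1_def A2_def)
  have "\<not> (A1 \<noteq> 0 \<and> A2 \<noteq> 0)"
  proof
    assume both: "A1 \<noteq> 0 \<and> A2 \<noteq> 0"
    show False
    proof (cases "norm (\<alpha> 2) \<le> norm (\<alpha> 1)")
      case True
      then show False using not_both_exponentials[OF n _ _ \<alpha> True feq[unfolded fz]] both by blast
    next
      case False
      then have le: "norm (\<alpha> 1) \<le> norm (\<alpha> 2)" by simp
      have "(A2 * exp (\<alpha> 2 * z) + A1 * exp (\<alpha> 1 * z) + poly q z) ^ (n - 1) *
         ((1 + w * \<alpha> 2) * A2 * exp (\<alpha> 2 * z) + (1 + w * \<alpha> 1) * A1 * exp (\<alpha> 1 * z) + poly s z)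
         = E2 * exp (\<alpha> 2 * z) + E1 * exp (\<alpha> 1 * z)" for z
        using feq[of z] unfolding fz by (simp add: add_ac)
      from not_both_exponentials[OF n _ _ \<alpha>(2,1) \<alpha>(3)[symmetric] le this] both show False by blast
    qed
  qed
  moreover have "\<not> (A1 = 0 \<and> A2 = 0)" using fz nonpoly by auto
  ultimately consider "A1 \<noteq> 0" "A2 = 0" | "A2 \<noteq> 0" "A1 = 0" by blast
  then show ?thesis
  proof cases
    case 1
    then have "E2 = p 2" using A2_0 by (simp add: E2_def)
    then have "\<exists>a C. a \<noteq> 0 \<and> C \<noteq> 0 \<and> (\<forall>z. f z = C * exp (a * z)) \<and> a = \<alpha> 1 \<and> of_nat n * a = \<alpha> 2 \<and>
       1 + a * w \<noteq> 0 \<and> (\<exists>u v. u ^ n = 1 + a * w \<and> v ^ n = p 2 \<and> C = inverse u * v)"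
      using 1 fz feq by (intro single_exponential_solution[OF n \<alpha> 1(1) assms(4), where q = q and ?E1.0 = E1]) (auto simp: s_def)
    then show ?thesis by (elim exE conjE, intro exI conjI bexI[of _ 1] bexI[of _ 2]) auto
  next
    case 2
    then have "E1 = p 1" using A1_0 by (simp add: E1_def)
    then have "\<exists>a C. a \<noteq> 0 \<and> C \<noteq> 0 \<and> (\<forall>z. f z = C * exp (a * z)) \<and> a = \<alpha> 2 \<and> of_nat n * a = \<alpha> 1 \<and>
       1 + a * w \<noteq> 0 \<and> (\<exists>u v. u ^ n = 1 + a * w \<and> v ^ n = p 1 \<and> C = inverse u * v)"
      using 2 fz feq by (intro single_exponential_solution[OF n \<alpha>(2,1) \<alpha>(3)[symmetric] 2(1) assms(3), where q = q and ?E1.0 = E2])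
        (auto simp: s_def add.commute)
    then show ?thesis by (elim exE conjE, intro exI conjI bexI[of _ 2] bexI[of _ 1]) auto
  qed
qed

end
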